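(* Let $X$ be a real normed space with finite dimension $d$ and suppose that the set of smooth points of $X$ forms an open subset of $X$. Let $G$ and $H$ be finite simple graphs, let $v_0\in V(G)$, and suppose $G'$ is obtained from $G$ by a vertex-to-$H$ substitution at $v_0$. If $G$ and $H$ are independent in $X$ then $G'$ is independent in $X$. Further, if $\dim\mathcal{T}(r)=d$ for any placement $r$ of $H$ and $H$ is rigid in $X$, then $G'$ is rigid in $X$ if and only if $G$ is rigid in $X$.
   Context: Vertex-to-$H$ substitution: $G'$ is obtained from $G$ by a vertex-to-$H$ substitution at $v_0\in V(G)$ if it is formed by replacing the vertex $v_0$ with $V(H)$ (taken disjoint from $V(G)\setminus\{v_0\}$), adding the edges $E(H)$, and changing each edge $v_0w\in E(G)$ to $vw$ for some $v\in V(H)$ (the choice of $v$ may depend on the edge). Let $X$ be a finite dimensional real normed space with dual $X^*$. A linear functional $f:X\to\mathbb{R}$ supports a non-zero point $x_0\in X$ if $f(x_0)=\|x_0\|^2$ and $\sup_{\|x\|\le1}|f(x)|=\|x_0\|$. If exactly one linear functional supports the non-zero point $x_0$ then $x_0$ is called smooth and $\varphi_{x_0}$ denotes this functional. A placement of $G=(V,E)$ in $X$ is a point $p=(p_v)_{v\in V}\in X^V$ with $p_v\neq p_w$ for each $vw\in E$; it is well-positioned if $p_v-p_w$ is smooth for every $vw\in E$. Fix a basis $b_1,\dots,b_d$ of $X$. For well-positioned $p$, the rigidity matrix $R(G,p)$ has rows indexed by $E$ and columns indexed by $V\times\{1,\dots,d\}$; for $e=vw$ its $(e,(v,k))$ entry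 is $\varphi_{p_v-p_w}(b_k)$, its $(e,(w,k))$ entry is $\varphi_{p_w-p_v}(b_k)=-\varphi_{p_v-p_w}(b_k)$, and the remaining entries of row $e$ are $0$. A framework $(G,p)$ with $p$ well-positioned is independent if the rows of $R(G,p)$ are linearly independent, and regular if $\operatorname{rank}R(G,p)$ is maximal among all well-positioned placements of $G$ in $X$. Let $\mathcal{O}_p$ be the set of $p'\in X^V$ for which there is an isometry $T:X\to X$ with $p_v=T(p'_v)$ for all $v\in V$; it is a smooth submanifold of $X^V$, and $\mathcal{T}(p)$ denotes its tangent space at $p$. A regular framework $(G,p)$ is rigid in $X$ if $\operatorname{rank}R(G,p)=d|V|-\dim\mathcal{T}(p)$. The graph $G$ is independent (resp. rigid) in $X$ if $(G,p)$ is independent (resp. rigid) for some placement $p$. *)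

theory Defs
  imports "HOL-Analysis.Analysis" "HOL-Analysis.Finite_Function_Topology"
begin

record 'v graph =
  verts :: "'v set"
  edges :: "'v set set"

definition finite_simple_graph :: "'v graph \<Rightarrow> bool" where
  "finite_simple_graph G \<longleftrightarrow> finite (verts G) \<and> (\<forall>e\<in>edges G. e \<subseteq> verts G \<and> card e = 2)"

text \<open>The function \<open>\<sigma>\<close> chooses, for each edge \<open>v0 w\<close> of \<open>G\<close>, the vertex of \<open>H\<close> to which
  that edge is moved; it is irrelevant on all other arguments.\<close>

definition vertex_to_graph_substitution ::
    "'v graph \<Rightarrow> 'v \<Rightarrow> 'v graph \<Rightarrow> 'v graph \<Rightarrow> bool" where
  "vertex_to_graph_substitution G v0 H G' \<longleftrightarrow>
     v0 \<in> verts G \<and> verts H \<inter> (verts G - {v0}) = {} \<and>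
     (\<exists>\<sigma>. (\<forall>w. {v0, w} \<in> edges G \<longrightarrow> \<sigma> w \<in> verts H) \<and>
        verts G' = (verts G - {v0}) \<union> verts H \<and>
        edges G' = {e \<in> edges G. v0 \<notin> e} \<union> edges H \<union> {{\<sigma> w, w} | w. {v0, w} \<in> edges G})"

text \<open>The normed space \<open>X\<close> is the type \<open>'a\<close>; finite dimensionality is expressed by a basis
  \<open>b 1, \<dots>, b d\<close>. The supremum below is over a bounded set in that case, since every linear
  functional is then continuous.\<close>

definition is_basis :: "(nat \<Rightarrow> 'a::real_vector) \<Rightarrow> nat \<Rightarrow> bool" where
  "is_basis b d \<longleftrightarrow> inj_on b {1..d} \<and> independent (b ` {1..d}) \<and> span (b ` {1..d}) = UNIV"

definition supports :: "('a::real_normed_vector \<Rightarrow> real) \<Rightarrow> 'a \<Rightarrow> bool" where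
  "supports f x0 \<longleftrightarrow> linear f \<and> f x0 = (norm x0)\<^sup>2 \<and> (SUP x\<in>{x. norm x \<le> 1}. \<bar>f x\<bar>) = norm x0"

definition smooth_point :: "'a::real_normed_vector \<Rightarrow> bool" where
  "smooth_point x0 \<longleftrightarrow> x0 \<noteq> 0 \<and> (\<exists>!f. supports f x0)"

definition support_functional :: "'a::real_normed_vector \<Rightarrow> 'a \<Rightarrow> real" where
  "support_functional x0 = (THE f. supports f x0)"

text \<open>For finite \<open>V\<close>, the space \<open>X\<^sup>V\<close> is realised as the subspace of those finitely supported
  functions \<open>'v \<Rightarrow>\<^sub>0 'a\<close> that vanish outside \<open>V\<close>. The library norm on this type is the sum of the
  norms of the values.\<close>

definition config_space :: "'v set \<Rightarrow> ('v \<Rightarrow>\<^sub>0 'a::real_normed_vector) set" where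
  "config_space V = {p. Poly_Mapping.keys p \<subseteq> V}"

definition placement :: "'v graph \<Rightarrow> ('v \<Rightarrow>\<^sub>0 'a::real_normed_vector) \<Rightarrow> bool" where
  "placement G p \<longleftrightarrow> p \<in> config_space (verts G) \<and>
     (\<forall>v w. {v, w} \<in> edges G \<longrightarrow> Poly_Mapping.lookup p v \<noteq> Poly_Mapping.lookup p w)"

definition well_positioned :: "'v graph \<Rightarrow> ('v \<Rightarrow>\<^sub>0 'a::real_normed_vector) \<Rightarrow> bool" where
  "well_positioned G p \<longleftrightarrow> placement G p \<and>
     (\<forall>v w. {v, w} \<in> edges G \<longrightarrow>
        smooth_point (Poly_Mapping.lookup p v - Poly_Mapping.lookup p w))"

text \<open>The entry in row \<open>e\<close> and column \<open>(v, k)\<close>; for \<open>v \<in> e\<close> the definite description denotes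
  the other endpoint of \<open>e\<close>, so no orientation of the edges is needed.\<close>

definition rigidity_matrix ::
    "(nat \<Rightarrow> 'a::real_normed_vector) \<Rightarrow> ('v \<Rightarrow>\<^sub>0 'a) \<Rightarrow> 'v set \<Rightarrow> 'v \<times> nat \<Rightarrow> real" where
  "rigidity_matrix b p e = (\<lambda>(v, k).
     if v \<in> e then
       support_functional
         (Poly_Mapping.lookup p v - Poly_Mapping.lookup p (THE w. e = {v, w})) (b k)
     else 0)"

text \<open>A row as a vector, restricted to the column set \<open>V \<times> {1..d}\<close>.\<close>

definition rigidity_row ::
    "(nat \<Rightarrow> 'a::real_normed_vector) \<Rightarrow> nat \<Rightarrow> 'v graph \<Rightarrow> ('v \<Rightarrow>\<^sub>0 'a) \<Rightarrow> 'v set \<Rightarrow> ('v \<times> nat \<Rightarrow>\<^sub>0 real)"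
  where
  "rigidity_row b d G p e =
     Abs_poly_mapping (\<lambda>c. if c \<in> verts G \<times> {1..d} then rigidity_matrix b p e c else 0)"

definition rigidity_rank ::
    "(nat \<Rightarrow> 'a::real_normed_vector) \<Rightarrow> nat \<Rightarrow> 'v graph \<Rightarrow> ('v \<Rightarrow>\<^sub>0 'a) \<Rightarrow> nat" where
  "rigidity_rank b d G p = dim (rigidity_row b d G p ` edges G)"

text \<open>Linear independence of the rows as a family indexed by the edges (equal rows for distinct
  edges count as dependent).\<close>

definition independent_framework ::
    "(nat \<Rightarrow> 'a::real_normed_vector) \<Rightarrow> nat \<Rightarrow> 'v graph \<Rightarrow> ('v \<Rightarrow>\<^sub>0 'a) \<Rightarrow> bool" where
  "independent_framework b d G p \<longleftrightarrow> well_positioned G p \<and>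
     (\<forall>c. (\<Sum>e\<in>edges G. c e *\<^sub>R rigidity_row b d G p e) = 0 \<longrightarrow> (\<forall>e\<in>edges G. c e = 0))"

definition regular_framework ::
    "(nat \<Rightarrow> 'a::real_normed_vector) \<Rightarrow> nat \<Rightarrow> 'v graph \<Rightarrow> ('v \<Rightarrow>\<^sub>0 'a) \<Rightarrow> bool" where
  "regular_framework b d G p \<longleftrightarrow> well_positioned G p \<and>
     (\<forall>q. well_positioned G q \<longrightarrow> rigidity_rank b d G q \<le> rigidity_rank b d G p)"

text \<open>The isometry \<open>T\<close> is an arbitrary distance-preserving map, not assumed linear or affine.\<close>

definition isometry_orbit ::
    "'v set \<Rightarrow> ('v \<Rightarrow>\<^sub>0 'a::real_normed_vector) \<Rightarrow> ('v \<Rightarrow>\<^sub>0 'a) set" where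
  "isometry_orbit V p = {p' \<in> config_space V.
     \<exists>T :: 'a \<Rightarrow> 'a. (\<forall>x y. dist (T x) (T y) = dist x y) \<and>
       (\<forall>v\<in>V. Poly_Mapping.lookup p v = T (Poly_Mapping.lookup p' v))}"

text \<open>The tangent space at \<open>x\<close> of a submanifold \<open>M\<close> of a normed space, as the set of velocities
  at \<open>x\<close> of continuously differentiable curves in \<open>M\<close> through \<open>x\<close>.\<close>

definition tangent_space :: "'b::real_normed_vector set \<Rightarrow> 'b \<Rightarrow> 'b set" where
  "tangent_space M x = {vector_derivative \<gamma> (at 0) | \<gamma>.
     \<exists>\<epsilon>>0. \<gamma> C1_differentiable_on {-\<epsilon><..<\<epsilon>} \<and> \<gamma> ` {-\<epsilon><..<\<epsilon>} \<subseteq> M \<and> \<gamma> 0 = x}"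

definition trivial_motions ::
    "'v graph \<Rightarrow> ('v \<Rightarrow>\<^sub>0 'a::real_normed_vector) \<Rightarrow> ('v \<Rightarrow>\<^sub>0 'a) set" where
  "trivial_motions G p = tangent_space (isometry_orbit (verts G) p) p"

definition rigid_framework ::
    "(nat \<Rightarrow> 'a::real_normed_vector) \<Rightarrow> nat \<Rightarrow> 'v graph \<Rightarrow> ('v \<Rightarrow>\<^sub>0 'a) \<Rightarrow> bool" where
  "rigid_framework b d G p \<longleftrightarrow> regular_framework b d G p \<and>
     int (rigidity_rank b d G p) = int (d * card (verts G)) - int (dim (trivial_motions G p))"

text \<open>The type of \<open>b\<close> determines the ambient space of the placements.\<close>

definition independent_graph ::
    "(nat \<Rightarrow> 'a::real_normed_vector) \<Rightarrow> nat \<Rightarrow> 'v graph \<Rightarrow> bool" where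
  "independent_graph b d G \<longleftrightarrow> (\<exists>p. independent_framework b d G p)"

definition rigid_graph ::
    "(nat \<Rightarrow> 'a::real_normed_vector) \<Rightarrow> nat \<Rightarrow> 'v graph \<Rightarrow> bool" where
  "rigid_graph b d G \<longleftrightarrow> (\<exists>p. rigid_framework b d G p)"

end

(*
  Let p and r be independent placements of G and H.  Put the vertices of H at p(v0) + eps r(u) and
  leave the other vertices at p.  After dividing the rows of the edges of H by eps, the rigidity
  matrix converges for eps -> 0, because the support functional is continuous on the open set of
  smooth points and homogeneous.  In the limit, adding up the columns of the vertices of H turns
  the rows of the edges of H into 0 and the other rows into the rows of R(G,p), so the limit rows
  are independent, and so are the rows for small eps.

  For rigidity only dim T(p) matters, since the ranks are now the numbers of edges.  If V(H) has
  two vertices, the hypothesis on H forces dim T(p) = d for every framework: a trivial motion that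
  moves two points differently can be copied to the line through them, where V(H) can be placed.
  This uses that isometries of X are affine on lines (Mazur-Ulam).  If V(H) is a single vertex,
  then H has no edges and G' is a relabelling of G.
*)
theory Submission
  imports Defs
begin

subsection \<open>Finite-dimensional normed spaces\<close>

text \<open>When all ranks are numbers of edges and trivial motions have dimension d, rigidity of a
  graph \<open>K\<close> says \<open>card (edges K) = d * card (verts K) - d\<close>. The
  substitution adds the edges of \<open>H\<close> and all but one of its vertices, so this equation
  for \<open>H\<close> makes those for \<open>G\<close> and \<open>G'\<close> equivalent. The
  difficulty is that the dimension hypothesis speaks of \<open>H\<close> only. With one vertex it
  says nothing about the isometries of X, since every motion of a point is a translation;
  \<open>G\<close> may then have more trivial motions, and an isomorphism replaces the count.

  The isometries defining an orbit may vary along a curve without any regularity, so they have no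
  velocity of their own. What can be transported is the difference of two points: a fixed linear map
  spreads it over collinear points, and affinity on lines shows that this map takes orbits to
  orbits.

  One estimate serves two ends: the norm of a combination of independent vectors is at least a
  constant times the l1 norm of its coefficients. For a basis it yields compact balls and bounded
  functionals, for rows it yields stability under perturbation.\<close>

lemma independent_family:
  assumes "finite I" "inj_on f I" "independent (f ` I)" "(\<Sum>i\<in>I. c i *\<^sub>R f i) = 0"
  shows "\<forall>i\<in>I. c i = 0"
proof
  fix i assume i: "i \<in> I"
  have "(\<Sum>v\<in>f ` I. c (the_inv_into I f v) *\<^sub>R v) = 0"
    unfolding sum.reindex[OF assms(2)] o_def assms(4)[symmetric]
    by (intro sum.cong) (simp_all add: the_inv_into_f_f[OF assms(2)])
  then have "c (the_inv_into I f (f i)) = 0"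
    using real_vector.independentD[OF assms(3) _ subset_refl, of "\<lambda>v. c (the_inv_into I f v)"] assms(1) i
    by simp
  then show "c i = 0" using i by (simp add: the_inv_into_f_f[OF assms(2)])
qed

text \<open>On the compact l1 unit sphere of coefficients the norm of the combination is continuous
  and, by independence, nonzero. Its minimum serves as \<delta>, and homogeneity covers all other
  coefficients. Compactness comes from Tychonoff's theorem in the product space of coefficient
  functions.\<close>

lemma linear_combination_lower_bound:
  fixes f :: "'i \<Rightarrow> 'b::real_normed_vector"
  assumes fin: "finite I"
    and indep: "\<And>c. (\<Sum>i\<in>I. c i *\<^sub>R f i) = 0 \<Longrightarrow> \<forall>i\<in>I. c i = 0"
  obtains \<delta> where "\<delta> > 0" "\<And>c. \<delta> * (\<Sum>i\<in>I. \<bar>c i\<bar>) \<le> norm (\<Sum>i\<in>I. c i *\<^sub>R f i)"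
proof -
  define B where "B = PiE UNIV (\<lambda>i. if i \<in> I then {-1..1::real} else {0})"
  define K where "K = B \<inter> {c. (\<Sum>i\<in>I. \<bar>c i\<bar>) = 1}"
  have "compactin (product_topology (\<lambda>i. euclidean) UNIV) B"
    unfolding B_def compactin_PiE by auto
  then have "compact B"
    by (simp add: euclidean_product_topology)
  moreover have "closed {c::'i \<Rightarrow> real. (\<Sum>i\<in>I. \<bar>c i\<bar>) = 1}"
    by (intro closed_Collect_eq continuous_intros continuous_on_product_coordinates)
  ultimately have K: "compact K"
    unfolding K_def by (rule compact_Int_closed)
  have normalized: "(\<lambda>i. if i \<in> I then c i / (\<Sum>i\<in>I. \<bar>c i\<bar>) else 0) \<in> K"
    if pos: "(\<Sum>i\<in>I. \<bar>c i\<bar>) > 0" for c :: "'i \<Rightarrow> real"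
  proof -
    define s where "s = (\<Sum>i\<in>I. \<bar>c i\<bar>)"
    have "\<bar>c i\<bar> \<le> s" if "i \<in> I" for i
      using member_le_sum[OF that _ fin, of "\<lambda>i. \<bar>c i\<bar>"] by (simp add: s_def)
    then have "c i / s \<in> {-1..1}" if "i \<in> I" for i
      using that pos unfolding s_def[symmetric] by (fastforce simp: field_simps abs_le_iff)
    moreover have "(\<Sum>i\<in>I. \<bar>if i \<in> I then c i / s else 0\<bar>) = (\<Sum>i\<in>I. \<bar>c i\<bar> / s)"
      using pos unfolding s_def[symmetric] by (intro sum.cong) auto
    then have "(\<Sum>i\<in>I. \<bar>if i \<in> I then c i / s else 0\<bar>) = 1"
      using pos by (simp add: s_def flip: sum_divide_distrib)
    ultimately show ?thesis
      unfolding s_def[symmetric] by (auto simp: K_def B_def PiE_iff)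
  qed
  show ?thesis
  proof (cases "K = {}")
    \<comment> \<open>\<open>K\<close> is empty exactly when \<open>I\<close> is; both sides of the
      estimate are then 0.\<close>
    case True
    have "(\<Sum>i\<in>I. \<bar>c i\<bar>) = 0" for c :: "'i \<Rightarrow> real"
      using normalized[of c] True by (metis antisym_conv1 empty_iff not_less sum_abs_ge_zero)
    then show ?thesis
      using that[of 1] by simp
  next
    case False
    have "continuous_on K (\<lambda>c. norm (\<Sum>i\<in>I. c i *\<^sub>R f i))"
      by (intro continuous_intros continuous_on_subset[OF continuous_on_product_coordinates]) auto
    then obtain c0 where c0: "c0 \<in> K"
      and min: "\<And>c. c \<in> K \<Longrightarrow> norm (\<Sum>i\<in>I. c0 i *\<^sub>R f i) \<le> norm (\<Sum>i\<in>I. c i *\<^sub>R f i)"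
      using continuous_attains_inf[OF K False] by blast
    have "(\<Sum>i\<in>I. c0 i *\<^sub>R f i) \<noteq> 0"
      using indep[of c0] c0 by (auto simp: K_def)
    moreover have "norm (\<Sum>i\<in>I. c0 i *\<^sub>R f i) * (\<Sum>i\<in>I. \<bar>c i\<bar>) \<le> norm (\<Sum>i\<in>I. c i *\<^sub>R f i)" for c
    proof (cases "(\<Sum>i\<in>I. \<bar>c i\<bar>) > 0")
      case True
      have "norm (\<Sum>i\<in>I. c0 i *\<^sub>R f i) \<le> norm (\<Sum>i\<in>I. (c i / (\<Sum>i\<in>I. \<bar>c i\<bar>)) *\<^sub>R f i)"
        using min[OF normalized[OF True]] by simp
      also have "(\<Sum>i\<in>I. (c i / (\<Sum>i\<in>I. \<bar>c i\<bar>)) *\<^sub>R f i) =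
          (1 / (\<Sum>i\<in>I. \<bar>c i\<bar>)) *\<^sub>R (\<Sum>i\<in>I. c i *\<^sub>R f i)"
        unfolding scaleR_sum_right by simp
      finally show ?thesis
        using True by (simp add: field_simps)
    next
      case False
      then have "(\<Sum>i\<in>I. \<bar>c i\<bar>) = 0"
        by (metis antisym_conv1 not_less sum_abs_ge_zero)
      then show ?thesis by simp
    qed
    ultimately show ?thesis
      using that[of "norm (\<Sum>i\<in>I. c0 i *\<^sub>R f i)"] by simp
  qed
qed

definition basis_coord :: "(nat \<Rightarrow> 'a::real_vector) \<Rightarrow> nat \<Rightarrow> 'a \<Rightarrow> nat \<Rightarrow> real" where
  "basis_coord b d x i = representation (b ` {1..d}) x (b i)"

lemma basis_coord_sum:
  assumes "is_basis b d"
  shows "(\<Sum>i=1..d. basis_coord b d x i *\<^sub>R b i) = x"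
proof -
  have ind: "independent (b ` {1..d})" and inj: "inj_on b {1..d}" and sp: "span (b ` {1..d}) = UNIV"
    using assms by (auto simp: is_basis_def)
  have "x = (\<Sum>v\<in>b ` {1..d}. representation (b ` {1..d}) x v *\<^sub>R v)"
    using real_vector.sum_representation_eq[OF ind, of x "b ` {1..d}"] sp by simp
  also have "\<dots> = (\<Sum>i=1..d. basis_coord b d x i *\<^sub>R b i)"
    by (subst sum.reindex[OF inj]) (simp add: basis_coord_def)
  finally show ?thesis by simp
qed

lemma is_basis_lower_bound:
  fixes b :: "nat \<Rightarrow> 'a::real_normed_vector"
  assumes "is_basis b d"
  obtains \<delta> where "\<delta> > 0" "\<And>c. \<delta> * (\<Sum>i=1..d. \<bar>c i\<bar>) \<le> norm (\<Sum>i=1..d. c i *\<^sub>R b i)"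
proof (rule linear_combination_lower_bound[of "{1..d}" b])
  show "\<forall>i\<in>{1..d}. c i = 0" if "(\<Sum>i=1..d. c i *\<^sub>R b i) = 0" for c
    using assms that by (intro independent_family[of "{1..d}" b]) (auto simp: is_basis_def)
qed (use that in auto)

text \<open>Expand x in the basis: the absolute values of its coordinates sum to at most
  \<open>norm x / \<delta>\<close>. Boundedness is what makes the supremum in
  \<open>supports\<close> a genuine one.\<close>

lemma is_basis_linear_bound:
  fixes b :: "nat \<Rightarrow> 'a::real_normed_vector" and f :: "'a \<Rightarrow> 'c::real_normed_vector"
  assumes "is_basis b d" "linear f"
  shows "bounded_linear f"
proof -
  obtain \<delta> where \<delta>: "\<delta> > 0" "\<And>c. \<delta> * (\<Sum>i=1..d. \<bar>c i\<bar>) \<le> norm (\<Sum>i=1..d. c i *\<^sub>R b i)"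
    using is_basis_lower_bound[OF assms(1)] by blast
  define M where "M = (\<Sum>i=1..d. norm (f (b i)))"
  have "norm (f x) \<le> norm x * (M / \<delta>)" for x
  proof -
    have "f x = (\<Sum>i=1..d. basis_coord b d x i *\<^sub>R f (b i))"
      using arg_cong[OF basis_coord_sum[OF assms(1), of x], of f]
      by (simp add: linear_sum[OF assms(2)] linear_scale[OF assms(2)])
    then have "norm (f x) \<le> (\<Sum>i=1..d. \<bar>basis_coord b d x i\<bar> * norm (f (b i)))"
      by (metis (no_types, lifting) norm_scaleR norm_sum sum.cong)
    also have "\<dots> \<le> (\<Sum>i=1..d. \<bar>basis_coord b d x i\<bar> * M)"
      unfolding M_def by (intro sum_mono mult_left_mono member_le_sum) auto
    also have "\<dots> = (\<Sum>i=1..d. \<bar>basis_coord b d x i\<bar>) * M"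
      by (simp add: sum_distrib_right)
    also have "\<dots> \<le> (norm x / \<delta>) * M"
    proof (rule mult_right_mono)
      show "(\<Sum>i=1..d. \<bar>basis_coord b d x i\<bar>) \<le> norm x / \<delta>"
        using \<delta>(2)[of "basis_coord b d x"] \<delta>(1)
        unfolding basis_coord_sum[OF assms(1)] by (simp add: field_simps)
    qed (simp add: M_def sum_nonneg)
    finally show ?thesis by simp
  qed
  then show ?thesis
    using assms(2) unfolding linear_iff by (intro bounded_linear_intro[where K = "M / \<delta>"]) auto
qed

text \<open>The ball is a closed subset of a compact set, the image of a box of coefficients under
  the continuous map \<open>F\<close>.\<close>

lemma is_basis_compact_cball:
  fixes b :: "nat \<Rightarrow> 'a::real_normed_vector"
  assumes "is_basis b d"
  shows "compact (cball (x::'a) r)"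
proof -
  obtain \<delta> where \<delta>: "\<delta> > 0" "\<And>c. \<delta> * (\<Sum>i=1..d. \<bar>c i\<bar>) \<le> norm (\<Sum>i=1..d. c i *\<^sub>R b i)"
    using is_basis_lower_bound[OF assms] by blast
  \<comment> \<open>Points of the ball have norm at most \<open>norm x + r\<close>, so dividing by
    \<delta> bounds their coordinates.\<close>
  define M where "M = (norm x + r) / \<delta>"
  define B where "B = PiE UNIV (\<lambda>i::nat. {-M..M})"
  define F where "F = (\<lambda>c. \<Sum>i=1..d. c i *\<^sub>R b i)"
  have "compactin (product_topology (\<lambda>i. euclidean) UNIV) B"
    unfolding B_def compactin_PiE by auto
  then have "compact B"
    by (simp add: euclidean_product_topology)
  moreover have "continuous_on B F"
    unfolding F_def
    by (intro continuous_intros continuous_on_subset[OF continuous_on_product_coordinates]) auto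
  ultimately have "compact (F ` B)"
    by (intro compact_continuous_image)
  moreover have "cball x r \<subseteq> F ` B"
  proof
    fix y assume "y \<in> cball x r"
    then have "norm y \<le> norm x + r"
      by (metis dist_commute dist_norm mem_cball norm_triangle_sub add_left_mono order_trans)
    then have *: "(\<Sum>i=1..d. \<bar>basis_coord b d y i\<bar>) \<le> M"
      using \<delta>(2)[of "basis_coord b d y"] \<delta>(1)
      unfolding basis_coord_sum[OF assms] by (simp add: M_def field_simps)
    \<comment> \<open>\<open>B\<close> constrains the coefficients at all natural numbers; those
      outside \<open>{1..d}\<close> do not affect \<open>F\<close> and are set to 0.\<close>
    define a where "a i = (if i \<in> {1..d} then basis_coord b d y i else 0)" for i
    have "\<bar>basis_coord b d y i\<bar> \<le> M" if "i \<in> {1..d}" for i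
      using member_le_sum[OF that, of "\<lambda>i. \<bar>basis_coord b d y i\<bar>"] * by simp
    moreover have "0 \<le> M"
      using order_trans[OF sum_abs_ge_zero *] .
    ultimately have "a \<in> B"
      by (auto simp: B_def a_def abs_le_iff minus_le_iff)
    moreover have "F a = (\<Sum>i=1..d. basis_coord b d y i *\<^sub>R b i)"
      unfolding F_def a_def by (rule sum.cong) auto
    then have "F a = y"
      by (simp only: basis_coord_sum[OF assms])
    ultimately show "y \<in> F ` B" by blast
  qed
  ultimately show ?thesis
    using compact_Int_closed[of "F ` B" "cball x r"] by (simp add: Int_absorb1)
qed

subsection \<open>Isometries\<close>

text \<open>A point y missed by the image has distance at least e from it. Since f preserves
  distances, any two iterates of y are then at least e apart, so they have no convergent
  subsequence.\<close>

lemma compact_isometry_image_eq: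
  fixes f :: "'a::metric_space \<Rightarrow> 'a"
  assumes K: "compact K" and sub: "f ` K \<subseteq> K"
    and iso: "\<And>x y. x \<in> K \<Longrightarrow> y \<in> K \<Longrightarrow> dist (f x) (f y) = dist x y"
  shows "f ` K = K"
proof (rule ccontr)
  assume "f ` K \<noteq> K"
  then obtain y where y: "y \<in> K" "y \<notin> f ` K" using sub by blast
  have "continuous_on K f"
    unfolding continuous_on_iff using iso by metis
  then have "closed (f ` K)"
    using K compact_continuous_image compact_imp_closed by blast
  then obtain e where e: "e > 0" "ball y e \<subseteq> - f ` K"
    using y(2) openE[of "- f ` K" y] by (metis ComplI closed_def)
  define s where "s = (\<lambda>n. (f ^^ n) y)"
  have s_in: "s n \<in> K" for n
    by (induction n) (use y sub in \<open>auto simp: s_def\<close>)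
  have shift: "dist (s (m + k)) (s m) = dist (s k) y" for m k
  proof (induction m)
    case (Suc m)
    have "dist (s (Suc m + k)) (s (Suc m)) = dist (f (s (m + k))) (f (s m))"
      by (simp add: s_def)
    then show ?case using Suc iso s_in by simp
  qed (simp add: s_def)
  have apart: "e \<le> dist (s n) (s m)" if "m < n" for m n
  proof -
    obtain k where k: "n = m + Suc k" using \<open>m < n\<close> less_imp_Suc_add by auto
    have "s (Suc k) \<in> f ` K" using s_in[of k] by (simp add: s_def)
    then have "s (Suc k) \<notin> ball y e" using e(2) by blast
    then show ?thesis using shift[of m "Suc k"] k by (simp add: dist_commute)
  qed
  obtain l r where "strict_mono r" "(s \<circ> r) \<longlonglongrightarrow> l"
    using K s_in by (metis compact_imp_seq_compact seq_compactE)
  then have "Cauchy (s \<circ> r)" by (simp add: LIMSEQ_imp_Cauchy)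
  then obtain N where "\<forall>m\<ge>N. \<forall>n\<ge>N. dist ((s \<circ> r) m) ((s \<circ> r) n) < e"
    using e(1) by (meson metric_CauchyD)
  then have "dist (s (r (Suc N))) (s (r N)) < e" by simp
  then show False
    using apart[of "r N" "r (Suc N)"] \<open>strict_mono r\<close> by (simp add: strict_mono_Suc_iff)
qed

text \<open>Mazur-Ulam needs surjectivity, while \<open>isometry_orbit\<close> only asks for
  preserved distances. After subtracting \<open>T 0\<close>, the map sends each compact ball about 0
  into itself, hence onto itself; the radius is chosen so that the ball contains the shifted target
  \<open>y - T 0\<close>.\<close>

lemma is_basis_isometry_surj:
  fixes b :: "nat \<Rightarrow> 'a::real_normed_vector" and T :: "'a \<Rightarrow> 'a"
  assumes "is_basis b d" and iso: "\<And>x y. dist (T x) (T y) = dist x y"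
  shows "surj T"
proof (rule surjI)
  fix y
  define K where "K = cball (0::'a) (norm (y - T 0))"
  have "(\<lambda>x. T x - T 0) ` K = K"
  proof (rule compact_isometry_image_eq)
    show "compact K" unfolding K_def by (rule is_basis_compact_cball[OF assms(1)])
    have "norm (T x - T 0) = norm x" for x
      using iso[of x 0] by (simp add: dist_norm)
    then show "(\<lambda>x. T x - T 0) ` K \<subseteq> K"
      unfolding K_def by (simp add: image_subset_iff)
    show "dist (T x - T 0) (T z - T 0) = dist x z" for x z
      using iso[of x z] by (simp add: dist_norm)
  qed
  moreover have "y - T 0 \<in> K" by (simp add: K_def)
  ultimately have "\<exists>x. T x = y" by (metis (no_types, lifting) diff_add_cancel imageE)
  then show "T (SOME x. T x = y) = y" by (rule someI_ex)
qed

text \<open>The argument of Vaisala: conjugating by the reflection in the midpoint turns an isometry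
  fixing both end points into another one that displaces the midpoint twice as far.\<close>

lemma isometry_fixes_midpoint:
  fixes V :: "'a::real_normed_vector \<Rightarrow> 'a"
  assumes "surj V" "\<And>u w. dist (V u) (V w) = dist u w" "V x = x" "V y = y"
  shows "V ((1/2) *\<^sub>R (x + y)) = (1/2) *\<^sub>R (x + y)"
proof -
  define z where "z = (1/2) *\<^sub>R (x + y)"
  define W where "W = {V :: 'a \<Rightarrow> 'a. surj V \<and> (\<forall>u w. dist (V u) (V w) = dist u w) \<and> V x = x \<and> V y = y}"
  define \<psi> where "\<psi> u = x + y - u" for u
  have \<psi>: "\<psi> (\<psi> u) = u" "dist (\<psi> u) (\<psi> w) = dist u w" "\<psi> z = z" "\<psi> x = y" "\<psi> y = x" for u w
    by (simp_all add: \<psi>_def z_def dist_norm norm_minus_commute)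
      (metis add_diff_cancel_left' scaleR_half_double scaleR_right_distrib)
  have \<psi>z: "dist (\<psi> u) u = 2 * dist u z" for u
  proof -
    have "\<psi> u - u = 2 *\<^sub>R (z - u)"
      by (simp add: \<psi>_def z_def scaleR_diff_right) (simp add: scaleR_2)
    then show ?thesis by (simp add: dist_norm norm_minus_commute)
  qed
  have bound: "dist (V z) z \<le> 2 * dist x z" if "V \<in> W" for V
  proof -
    have "dist (V z) z \<le> dist (V z) (V x) + dist x z"
      using dist_triangle[of "V z" z x] that by (simp add: W_def dist_commute)
    also have "dist (V z) (V x) = dist z x"
      using that unfolding W_def by blast
    finally show ?thesis by (simp add: dist_commute)
  qed
  have double: "\<exists>V'\<in>W. dist (V' z) z = 2 * dist (V z) z" if V: "V \<in> W" for V
  proof -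
    have iso: "dist (V u) (V w) = dist u w" for u w using V by (simp add: W_def)
    then have "inj V" by (metis dist_eq_0_iff injI)
    with V have inv: "V (inv V u) = u" "inv V (V u) = u" for u
      by (simp_all add: W_def surj_f_inv_f)
    define V' where "V' = \<psi> \<circ> inv V \<circ> \<psi> \<circ> V"
    have inv_iso: "dist (inv V u) (inv V w) = dist u w" for u w
      using iso[of "inv V u" "inv V w"] by (simp add: inv)
    have "surj V'"
      by (rule surjI[where f = "inv V \<circ> \<psi> \<circ> V \<circ> \<psi>"]) (simp add: V'_def inv \<psi>)
    moreover have "V' x = x" "V' y = y"
      using V inv(2)[of x] inv(2)[of y] by (simp_all add: V'_def W_def \<psi>)
    ultimately have "V' \<in> W" by (simp add: W_def V'_def iso inv_iso \<psi>)
    moreover have "dist (V' z) z = 2 * dist (V z) z"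
    proof -
      have "dist (V' z) z = dist (inv V (\<psi> (V z))) z"
        using \<psi>(2)[of "inv V (\<psi> (V z))" z] by (simp add: V'_def \<psi>)
      also have "\<dots> = dist (\<psi> (V z)) (V z)"
        using iso[of "inv V (\<psi> (V z))" z] by (simp add: inv)
      finally show ?thesis by (simp add: \<psi>z)
    qed
    ultimately show ?thesis by blast
  qed
  have bdd: "bdd_above ((\<lambda>V. dist (V z) z) ` W)"
    using bound by (intro bdd_aboveI2) auto
  have V: "V \<in> W" using assms by (simp add: W_def)
  \<comment> \<open>If s is the supremum of the displacements over \<open>W\<close>, doubling within
    \<open>W\<close> bounds each displacement by s / 2. So s is at most s / 2, and being finite it
    cannot be positive.\<close>
  have "dist (V z) z \<le> (SUP V\<in>W. dist (V z) z) / 2" if "V \<in> W" for V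
    using double[OF that] cSUP_upper[OF _ bdd] by force
  then have "(SUP V\<in>W. dist (V z) z) \<le> (SUP V\<in>W. dist (V z) z) / 2"
    using V by (intro cSUP_least) auto
  then have "dist (V z) z \<le> 0"
    using cSUP_upper[OF V bdd] by linarith
  then show ?thesis by (simp add: z_def)
qed

lemma Mazur_Ulam_midpoint:
  fixes T :: "'a::real_normed_vector \<Rightarrow> 'a"
  assumes surj: "surj T" and iso: "\<And>u w. dist (T u) (T w) = dist u w"
  shows "T ((1/2) *\<^sub>R (x + y)) = (1/2) *\<^sub>R (T x + T y)"
proof -
  have "inj T" using iso by (metis dist_eq_0_iff injI)
  then have inv: "T (inv T u) = u" "inv T (T u) = u" for u
    using surj by (simp_all add: surj_f_inv_f)
  \<comment> \<open>\<open>T\<close>, then the reflection in the midpoint of \<open>T x\<close> and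
    \<open>T y\<close>, then \<open>inv T\<close>, then the reflection in the midpoint of x and y:
    an isometry that fixes x and y.\<close>
  define V where "V u = x + y - inv T (T x + T y - T u)" for u
  have V_mid: "V ((1/2) *\<^sub>R (x + y)) = (1/2) *\<^sub>R (x + y)"
  proof (rule isometry_fixes_midpoint[of V])
    show "surj V"
      by (rule surjI[where f = "\<lambda>u. inv T (T x + T y - T (x + y - u))"]) (simp add: V_def inv)
    show "dist (V u) (V w) = dist u w" for u w
    proof -
      have "dist (V u) (V w) = dist (inv T (T x + T y - T u)) (inv T (T x + T y - T w))"
        by (simp add: V_def dist_norm norm_minus_commute)
      also have "\<dots> = dist (T x + T y - T u) (T x + T y - T w)"
        using iso[of "inv T (T x + T y - T u)" "inv T (T x + T y - T w)"] by (simp add: inv)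
      also have "\<dots> = dist (T u) (T w)"
        by (simp add: dist_norm norm_minus_commute)
      finally show ?thesis by (simp add: iso)
    qed
  qed (simp_all add: V_def inv)
  then have "inv T (T x + T y - T ((1/2) *\<^sub>R (x + y))) = (1/2) *\<^sub>R (x + y)"
  proof -
    have "s - (1/2) *\<^sub>R s = (1/2) *\<^sub>R s" for s :: 'a
      by (simp add: diff_eq_eq flip: scaleR_left_distrib)
    from this[of "x + y"] V_mid show ?thesis
      unfolding V_def by (metis diff_diff_eq2 add_diff_cancel_left')
  qed
  then have "T x + T y - T ((1/2) *\<^sub>R (x + y)) = T ((1/2) *\<^sub>R (x + y))"
    using inv(1) by metis
  then have "T x + T y = 2 *\<^sub>R T ((1/2) *\<^sub>R (x + y))"
    by (simp add: scaleR_2 algebra_simps)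
  then show ?thesis by simp
qed

text \<open>The defect \<open>D\<close> is additive and vanishes at the integers, so it has period 1
  and is bounded by its values on [0,1). A bounded additive map is zero, because its value at n t is
  n times its value at t.\<close>

lemma additive_bounded_imp_scaleR:
  fixes S :: "real \<Rightarrow> 'a::real_normed_vector"
  assumes add: "\<And>s t. S (s + t) = S s + S t"
    and bounded: "\<And>t. norm (S t) \<le> M * \<bar>t\<bar>"
  shows "S t = t *\<^sub>R S 1"
proof -
  define D where "D t = S t - t *\<^sub>R S 1" for t
  have D_add: "D (s + t) = D s + D t" for s t
    by (simp add: D_def add algebra_simps)
  interpret D: additive D by standard (rule D_add)
  have nat_D: "D (of_nat n * t) = of_nat n *\<^sub>R D t" for n t
    by (induction n) (simp_all add: D.zero D_add algebra_simps)
  have int_D: "D (of_int k) = 0" for k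
  proof (cases k rule: int_cases2)
    case (nonneg n)
    then show ?thesis using nat_D[of n 1] by (simp add: D_def)
  next
    case (nonpos n)
    then show ?thesis using nat_D[of n 1] by (simp add: D.minus) (simp add: D_def)
  qed
  \<comment> \<open>On [0,1) both \<open>S t\<close> and \<open>t *\<^sub>R S 1\<close> have norm at
    most M.\<close>
  have bounded_D: "norm (D t) \<le> 2 * M" for t
  proof -
    have M: "0 \<le> M" using bounded[of 1] norm_ge_zero[of "S 1"] by (simp del: norm_ge_zero)
    have "D t = D (of_int \<lfloor>t\<rfloor> + frac t)" by (simp add: frac_def)
    also have "\<dots> = D (frac t)" by (simp only: D_add int_D add_0)
    also have "norm \<dots> \<le> norm (S (frac t)) + frac t * norm (S 1)"
      unfolding D_def by (rule order_trans[OF norm_triangle_ineq4]) (simp add: frac_ge_0)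
    also have "\<dots> \<le> M * frac t + frac t * M"
      using bounded[of "frac t"] bounded[of 1]
      by (intro add_mono mult_left_mono) (auto simp: frac_ge_0)
    also have "\<dots> = (2 * M) * frac t" by simp
    also have "\<dots> \<le> (2 * M) * 1"
      using M frac_lt_1[of t] by (intro mult_left_mono) auto
    finally show ?thesis by simp
  qed
  have "norm (D t) = 0"
  proof (rule ccontr)
    assume "norm (D t) \<noteq> 0"
    then obtain n where "2 * M < of_nat n * norm (D t)"
      using reals_Archimedean3[of "norm (D t)"] by auto
    moreover have "of_nat n * norm (D t) \<le> 2 * M"
      using bounded_D[of "of_nat n * t"] by (simp add: nat_D)
    ultimately show False by simp
  qed
  then show ?thesis by (simp add: D_def)
qed

text \<open>\<open>S\<close> follows \<open>T\<close> along the line, relative to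
  \<open>T x\<close>. Preserved midpoints give Jensen's equation for \<open>S\<close>, and preserved
  distances give the linear bound that excludes pathological additive maps.\<close>

lemma is_basis_isometry_line:
  fixes b :: "nat \<Rightarrow> 'a::real_normed_vector" and T :: "'a \<Rightarrow> 'a"
  assumes "is_basis b d" and iso: "\<And>x y. dist (T x) (T y) = dist x y"
  shows "T (x + c *\<^sub>R (y - x)) = T x + c *\<^sub>R (T y - T x)"
proof -
  define S where "S t = T (x + t *\<^sub>R (y - x)) - T x" for t
  have mid: "T ((1/2) *\<^sub>R (u + w)) = (1/2) *\<^sub>R (T u + T w)" for u w
    using Mazur_Ulam_midpoint[OF is_basis_isometry_surj[OF assms] iso] .
  have half: "S ((s + t) / 2) = (1/2) *\<^sub>R (S s + S t)" for s t
  proof -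
    have "(x + s *\<^sub>R (y - x)) + (x + t *\<^sub>R (y - x)) = 2 *\<^sub>R (x + ((s + t) / 2) *\<^sub>R (y - x))"
    proof -
      have "2 * ((s + t) / 2) = s + t" by simp
      then show ?thesis
        by (simp only: scaleR_right_distrib scaleR_scaleR) (simp add: scaleR_2 scaleR_left_distrib)
    qed
    then have "x + ((s + t) / 2) *\<^sub>R (y - x) =
        (1/2) *\<^sub>R ((x + s *\<^sub>R (y - x)) + (x + t *\<^sub>R (y - x)))"
      by simp
    moreover have "(a - c) + (b - c) = (a + b) - 2 *\<^sub>R c" for a b c :: 'a
      by (simp add: scaleR_2)
    ultimately show ?thesis
      unfolding S_def by (simp only: mid) (simp add: scaleR_diff_right)
  qed
  have S0: "S 0 = 0" by (simp add: S_def)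
  have "S c = c *\<^sub>R S 1"
  proof (rule additive_bounded_imp_scaleR)
    \<comment> \<open>Both instances of \<open>half\<close> compute \<open>S ((s + t) / 2)\<close>,
      the first one with the help of \<open>S 0 = 0\<close>.\<close>
    show "S (s + t) = S s + S t" for s t
      using half[of "s + t" 0] half[of s t] by (simp add: S0)
    show "norm (S t) \<le> norm (y - x) * \<bar>t\<bar>" for t
      using iso[of "x + t *\<^sub>R (y - x)" x] by (simp add: S_def dist_norm)
  qed
  then show ?thesis by (simp add: S_def algebra_simps)
qed

subsection \<open>Support functionals\<close>

text \<open>Pointwise inequalities, unlike the supremum, pass easily to limits and multiples.
  Conversely they suffice because the value \<open>norm x\<close> is attained at
  \<open>sgn x\<close>.\<close>

lemma is_basis_supports_iff:
  fixes b :: "nat \<Rightarrow> 'a::real_normed_vector" and x :: 'a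
  assumes "is_basis b d"
  shows "supports f x \<longleftrightarrow>
    linear f \<and> f x = (norm x)\<^sup>2 \<and> (\<forall>y. \<bar>f y\<bar> \<le> norm x * norm y)"
proof
  assume supp: "supports f x"
  then have lin: "linear f" and fx: "f x = (norm x)\<^sup>2"
    and Sup: "(SUP x\<in>{x. norm x \<le> 1}. \<bar>f x\<bar>) = norm x"
    by (simp_all add: supports_def)
  obtain K where "K > 0" "\<And>y. norm (f y) \<le> norm y * K"
    using is_basis_linear_bound[OF assms lin] by (metis bounded_linear.pos_bounded)
  then have "\<bar>f y\<bar> \<le> K" if "norm y \<le> 1" for y
    using that mult_right_mono[of "norm y" 1 K] by (metis less_imp_le mult_1 order_trans real_norm_def)
  then have bdd: "bdd_above ((\<lambda>x. \<bar>f x\<bar>) ` {x. norm x \<le> 1})"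
    by (intro bdd_aboveI2) auto
  have "\<bar>f y\<bar> \<le> norm x * norm y" for y
  proof (cases "y = 0")
    case False
    have "\<bar>f ((1 / norm y) *\<^sub>R y)\<bar> \<le> norm x"
      unfolding Sup[symmetric] by (rule cSUP_upper[OF _ bdd]) simp
    then show ?thesis
      using False by (simp add: linear_scale[OF lin] field_simps)
  qed (simp add: linear_0[OF lin])
  with lin fx show "linear f \<and> f x = (norm x)\<^sup>2 \<and> (\<forall>y. \<bar>f y\<bar> \<le> norm x * norm y)"
    by blast
next
  assume *: "linear f \<and> f x = (norm x)\<^sup>2 \<and> (\<forall>y. \<bar>f y\<bar> \<le> norm x * norm y)"
  have "(SUP x\<in>{x. norm x \<le> 1}. \<bar>f x\<bar>) = norm x"
  proof (rule cSup_eq_maximum)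
    have "\<bar>f (sgn x)\<bar> = norm x"
      using * by (cases "x = 0") (simp_all add: sgn_div_norm linear_scale power2_eq_square linear_0)
    moreover have "norm (sgn x) \<le> 1"
      by (simp add: norm_sgn)
    ultimately show "norm x \<in> (\<lambda>x. \<bar>f x\<bar>) ` {x. norm x \<le> 1}"
      by (metis (mono_tags, lifting) image_eqI mem_Collect_eq)
    show "z \<le> norm x" if z: "z \<in> (\<lambda>x. \<bar>f x\<bar>) ` {x. norm x \<le> 1}" for z
    proof -
      obtain y where y: "z = \<bar>f y\<bar>" "norm y \<le> 1" using z by auto
      have "\<bar>f y\<bar> \<le> norm x * norm y" using * by blast
      also have "\<dots> \<le> norm x * 1" using y(2) by (intro mult_left_mono) auto
      finally show ?thesis using y(1) by simp
    qed
  qed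
  with * show "supports f x" by (simp add: supports_def)
qed

lemma support_functional_supports:
  "smooth_point x \<Longrightarrow> supports (support_functional x) x"
  unfolding smooth_point_def support_functional_def using theI'[of "\<lambda>f. supports f x"] by blast

lemma support_functional_unique:
  "smooth_point x \<Longrightarrow> supports f x \<Longrightarrow> support_functional x = f"
  using support_functional_supports unfolding smooth_point_def by blast

lemma is_basis_supports_scaleR:
  fixes b :: "nat \<Rightarrow> 'a::real_normed_vector" and x :: 'a
  assumes b: "is_basis b d" and "supports f x"
  shows "supports (\<lambda>y. c * f y) (c *\<^sub>R x)"
proof -
  have f: "linear f" "f x = (norm x)\<^sup>2" "\<bar>f y\<bar> \<le> norm x * norm y" for y
    using assms(2) unfolding is_basis_supports_iff[OF b] by auto
  have "linear (\<lambda>y. c * f y)"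
    using f(1) by (simp add: linear_iff algebra_simps)
  moreover have "\<bar>c\<bar> * \<bar>f y\<bar> \<le> \<bar>c\<bar> * (norm x * norm y)" for y
    using f(3) by (intro mult_left_mono) auto
  ultimately show ?thesis
    unfolding is_basis_supports_iff[OF b]
    by (simp add: linear_scale[OF f(1)] f(2) abs_mult power_mult_distrib power2_eq_square ac_simps)
qed

text \<open>Multiplication by c matches the support functionals of x with those of
  \<open>c *\<^sub>R x\<close>, so uniqueness transfers. The value -1 gives the antisymmetry of a
  row, small positive values the scaling of the rows of \<open>H\<close>.\<close>

lemma is_basis_smooth_point_scaleR:
  fixes b :: "nat \<Rightarrow> 'a::real_normed_vector" and x :: 'a
  assumes b: "is_basis b d" and x: "smooth_point x" and c: "c \<noteq> 0"
  shows "smooth_point (c *\<^sub>R x)"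
    and "support_functional (c *\<^sub>R x) = (\<lambda>y. c * support_functional x y)"
proof -
  have supp: "supports (\<lambda>y. c * support_functional x y) (c *\<^sub>R x)"
    by (rule is_basis_supports_scaleR[OF b support_functional_supports[OF x]])
  have "f = (\<lambda>y. c * support_functional x y)" if "supports f (c *\<^sub>R x)" for f
  proof -
    have "supports (\<lambda>y. inverse c * f y) x"
      using is_basis_supports_scaleR[OF b that, of "inverse c"] c by simp
    then show ?thesis
      using c by (simp add: support_functional_unique[OF x] fun_eq_iff)
  qed
  then show smooth: "smooth_point (c *\<^sub>R x)"
    using supp c x unfolding smooth_point_def by auto
  show "support_functional (c *\<^sub>R x) = (\<lambda>y. c * support_functional x y)"
    by (rule support_functional_unique[OF smooth supp])
qed

text \<open>The values on the basis stay in a compact box. Along a convergent subsequence of these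
  values, linearity extends the limit to all of X, and the conditions of
  \<open>is_basis_supports_iff\<close> are closed.\<close>

lemma is_basis_supports_subseq:
  fixes b :: "nat \<Rightarrow> 'a::real_normed_vector" and x :: 'a
  assumes b: "is_basis b d" and X: "X \<longlonglongrightarrow> x" and supp: "\<And>n. supports (\<phi> n) (X n)"
  obtains f r where "strict_mono r" "supports f x" "\<And>y. (\<lambda>n. \<phi> (r n) y) \<longlonglongrightarrow> f y"
proof -
  have lin: "linear (\<phi> n)" and \<phi>X: "\<phi> n (X n) = (norm (X n))\<^sup>2"
    and bound: "\<bar>\<phi> n y\<bar> \<le> norm (X n) * norm y" for n y
    using supp unfolding is_basis_supports_iff[OF b] by auto
  obtain M where M: "\<And>n. norm (X n) \<le> M"
    using convergent_imp_Bseq[of X] X unfolding convergent_def Bseq_def by blast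
  define B where "B = PiE UNIV (\<lambda>i::nat. {- (M * norm (b i)) .. M * norm (b i)})"
  have "compactin (product_topology (\<lambda>i. euclidean) UNIV) B"
    unfolding B_def compactin_PiE by auto
  then have "seq_compact B"
    by (simp add: euclidean_product_topology compact_imp_seq_compact)
  moreover have "\<bar>\<phi> n (b i)\<bar> \<le> M * norm (b i)" for n i
    using order_trans[OF bound mult_right_mono[OF M norm_ge_zero]] .
  then have "(\<lambda>i. \<phi> n (b i)) \<in> B" for n
    by (simp add: B_def PiE_iff abs_le_iff minus_le_iff)
  ultimately obtain l r where r: "strict_mono r" and l: "((\<lambda>n i. \<phi> n (b i)) \<circ> r) \<longlonglongrightarrow> l"
    by (metis seq_compactE)
  have coord: "(\<lambda>n. \<phi> (r n) (b i)) \<longlonglongrightarrow> l i" for i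
    using continuous_on_tendsto_compose[OF continuous_on_product_coordinates l, of i]
    by (simp add: o_def)
  define f where "f y = (\<Sum>i=1..d. basis_coord b d y i * l i)" for y
  have expand: "\<phi> n y = (\<Sum>i=1..d. basis_coord b d y i * \<phi> n (b i))" for n y
    using arg_cong[OF basis_coord_sum[OF b, of y], of "\<phi> n"]
    by (simp add: linear_sum[OF lin] linear_scale[OF lin])
  have lim: "(\<lambda>n. \<phi> (r n) y) \<longlonglongrightarrow> f y" for y
  proof -
    have "(\<lambda>n. \<Sum>i=1..d. basis_coord b d y i * \<phi> (r n) (b i)) \<longlonglongrightarrow> f y"
      unfolding f_def by (intro tendsto_intros coord)
    then show ?thesis unfolding expand[symmetric] .
  qed
  have Xr: "(\<lambda>n. X (r n)) \<longlonglongrightarrow> x"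
    using LIMSEQ_subseq_LIMSEQ[OF X r] by (simp add: o_def)
  have "linear f"
  proof (rule linearI)
    show "f (y + z) = f y + f z" for y z
      using LIMSEQ_unique[OF lim[of "y + z"]] tendsto_add[OF lim[of y] lim[of z]]
      by (simp add: linear_add[OF lin])
    show "f (c *\<^sub>R y) = c *\<^sub>R f y" for c y
      using LIMSEQ_unique[OF lim[of "c *\<^sub>R y"]] tendsto_scaleR[OF tendsto_const lim[of y], of c]
      by (simp add: linear_scale[OF lin])
  qed
  moreover have "\<bar>f y\<bar> \<le> norm x * norm y" for y
    by (rule LIMSEQ_le[OF tendsto_rabs[OF lim] tendsto_mult[OF tendsto_norm[OF Xr] tendsto_const]])
      (use bound in auto)
  moreover have "f x = (norm x)\<^sup>2"
  proof -
    \<comment> \<open>Functional and argument vary together here. The value at x is split into those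
      at \<open>x - X (r n)\<close> and at \<open>X (r n)\<close>; the first tends to 0 because the
      functionals have bounded norms.\<close>
    have "(\<lambda>n. \<phi> (r n) (x - X (r n))) \<longlonglongrightarrow> 0"
    proof (rule Lim_null_comparison)
      show "\<forall>\<^sub>F n in sequentially. norm (\<phi> (r n) (x - X (r n))) \<le> norm (X (r n)) * norm (x - X (r n))"
        using bound by simp
      have "(\<lambda>n. norm (X (r n)) * norm (x - X (r n))) \<longlonglongrightarrow> norm x * norm (x - x)"
        by (intro tendsto_intros Xr)
      then show "(\<lambda>n. norm (X (r n)) * norm (x - X (r n))) \<longlonglongrightarrow> 0" by simp
    qed
    moreover have "(\<lambda>n. \<phi> (r n) (X (r n))) \<longlonglongrightarrow> (norm x)\<^sup>2"
      unfolding \<phi>X by (intro tendsto_intros Xr)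
    ultimately have "(\<lambda>n. \<phi> (r n) (x - X (r n)) + \<phi> (r n) (X (r n))) \<longlonglongrightarrow> 0 + (norm x)\<^sup>2"
      by (rule tendsto_add)
    then show ?thesis
      using LIMSEQ_unique[OF lim[of x]] by (simp add: linear_diff[OF lin])
  qed
  ultimately have "supports f x"
    unfolding is_basis_supports_iff[OF b] by blast
  with r lim show ?thesis using that by blast
qed

text \<open>A subsequence staying away from the claimed limit would have a further subsequence
  converging to a support functional of x, and x has only one.\<close>

lemma is_basis_support_functional_tendsto:
  fixes b :: "nat \<Rightarrow> 'a::real_normed_vector" and x :: 'a
  assumes b: "is_basis b d" and X: "X \<longlonglongrightarrow> x"
    and smooth: "\<And>n. smooth_point (X n)" "smooth_point x"
  shows "(\<lambda>n. support_functional (X n) y) \<longlonglongrightarrow> support_functional x y"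
proof (rule ccontr)
  let ?\<phi> = "\<lambda>n. support_functional (X n)"
  assume "\<not> ?thesis"
  then obtain e where e: "e > 0"
    and far: "\<And>N. \<exists>n\<ge>N. e \<le> dist (?\<phi> n y) (support_functional x y)"
    unfolding LIMSEQ_def by (meson not_less)
  define N where "N = {n. e \<le> dist (?\<phi> n y) (support_functional x y)}"
  have "infinite N"
    using far by (auto simp: infinite_nat_iff_unbounded_le N_def)
  then obtain s :: "nat \<Rightarrow> nat" where s: "strict_mono s" "\<And>n. s n \<in> N"
    using infinite_enumerate by blast
  have "(\<lambda>n. X (s n)) \<longlonglongrightarrow> x"
    using LIMSEQ_subseq_LIMSEQ[OF X s(1)] by (simp add: o_def)
  then obtain f r where "supports f x" and lim: "\<And>y. (\<lambda>n. ?\<phi> (s (r n)) y) \<longlonglongrightarrow> f y"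
    using is_basis_supports_subseq[OF b, of "\<lambda>n. X (s n)" x "\<lambda>n. ?\<phi> (s n)"]
      support_functional_supports[OF smooth(1)] by metis
  then have "(\<lambda>n. ?\<phi> (s (r n)) y) \<longlonglongrightarrow> support_functional x y"
    using support_functional_unique[OF smooth(2)] by metis
  then obtain n where "dist (?\<phi> (s (r n)) y) (support_functional x y) < e"
    using e unfolding LIMSEQ_def by blast
  with s(2)[of "r n"] show False by (simp add: N_def)
qed

subsection \<open>Tangent spaces of isometry orbits\<close>

text \<open>\<open>dim\<close> is 0 for sets that span an infinite-dimensional space, so it is not
  monotone in general; the finite set \<open>W\<close> excludes this.\<close>

lemma card_independent_le_dim:
  assumes "independent I" "I \<subseteq> T" "T \<subseteq> span W" "finite W"
  shows "card I \<le> dim T"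
proof -
  obtain B where B: "I \<subseteq> B" "B \<subseteq> T" "independent B" "T \<subseteq> span B"
    using real_vector.maximal_independent_subset_extend[OF assms(2,1)] by blast
  have "finite B"
    using real_vector.independent_span_bound[OF assms(4) B(3)] B(2) assms(3) by auto
  then have "card I \<le> card B" using B(1) by (rule card_mono)
  also have "card B = dim T" by (rule real_vector.basis_card_eq_dim[OF B(2,4,3)])
  finally show ?thesis .
qed

section \<open>Configurations as finitely supported functions\<close>

lemma lookup_scaleR [simp]:
  "Poly_Mapping.lookup (c *\<^sub>R p) v = c *\<^sub>R Poly_Mapping.lookup p v"
  for p :: "'v \<Rightarrow>\<^sub>0 'a::real_vector"
proof -
  have "finite {i. c *\<^sub>R Poly_Mapping.lookup p i \<noteq> 0}"
    by (rule finite_subset[OF _ finite_lookup[of p]]) auto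
  then show ?thesis by (simp add: scaleR_poly_mapping_def)
qed

lemma norm_poly_mapping_eq_sum:
  fixes p :: "'v \<Rightarrow>\<^sub>0 'a::real_normed_vector"
  assumes "finite A" "Poly_Mapping.keys p \<subseteq> A"
  shows "norm p = (\<Sum>v\<in>A. norm (Poly_Mapping.lookup p v))"
proof -
  have "norm p = (\<Sum>v\<in>Poly_Mapping.keys p. norm (Poly_Mapping.lookup p v))"
    by (simp add: norm_poly_mapping_def dist_poly_mapping_def)
  also have "\<dots> = (\<Sum>v\<in>A. norm (Poly_Mapping.lookup p v))"
    using assms by (intro sum.mono_neutral_left) (auto simp: in_keys_iff)
  finally show ?thesis .
qed

lemma norm_lookup_le: "norm (Poly_Mapping.lookup p v) \<le> norm p"
  for p :: "'v \<Rightarrow>\<^sub>0 'a::real_normed_vector"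
proof -
  have "norm (Poly_Mapping.lookup p v) \<le> (\<Sum>u\<in>insert v (Poly_Mapping.keys p). norm (Poly_Mapping.lookup p u))"
    by (rule member_le_sum) auto
  also have "\<dots> = norm p"
    by (rule norm_poly_mapping_eq_sum[symmetric]) auto
  finally show ?thesis .
qed

lemma bounded_linear_lookup:
  "bounded_linear (\<lambda>p :: 'v \<Rightarrow>\<^sub>0 'a::real_normed_vector. Poly_Mapping.lookup p v)"
  by (rule bounded_linear_intro[where K = 1]) (simp_all add: lookup_add norm_lookup_le)

lemma bounded_linear_single:
  "bounded_linear (Poly_Mapping.single v :: 'a::real_normed_vector \<Rightarrow> 'v \<Rightarrow>\<^sub>0 'a)"
proof (rule bounded_linear_intro[where K = 1])
  show "Poly_Mapping.single v (c *\<^sub>R x) = c *\<^sub>R (Poly_Mapping.single v x :: 'v \<Rightarrow>\<^sub>0 'a)" for c and x :: 'a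
    by (rule poly_mapping_eqI) (simp add: lookup_single when_def)
  show "norm (Poly_Mapping.single v x) \<le> norm x * 1" for x :: 'a
    by (subst norm_poly_mapping_eq_sum[of "{v}"]) auto
qed (simp add: single_add)

text \<open>A sum of \<open>single\<close> rather than an abstraction of a function: linearity in
  the values is then inherited, as in \<open>bounded_linear_config_of\<close>. For infinite
  \<open>V\<close> the result is 0.\<close>

definition config_of :: "'v set \<Rightarrow> ('v \<Rightarrow> 'a) \<Rightarrow> ('v \<Rightarrow>\<^sub>0 'a::real_normed_vector)" where
  "config_of V f = (\<Sum>v\<in>V. Poly_Mapping.single v (f v))"

lemma lookup_config_of:
  assumes "finite V"
  shows "Poly_Mapping.lookup (config_of V f) v = (if v \<in> V then f v else 0)"
  using assms by (simp add: config_of_def lookup_sum lookup_single when_def)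

lemma config_of_in_config_space:
  assumes "finite V"
  shows "config_of V f \<in> config_space V"
  using assms by (auto simp: config_space_def in_keys_iff lookup_config_of split: if_splits)

lemma config_of_lookup:
  assumes "finite V" "p \<in> config_space V"
  shows "config_of V (Poly_Mapping.lookup p) = p"
  using assms
  by (intro poly_mapping_eqI) (auto simp: config_space_def in_keys_iff lookup_config_of)

lemma config_space_eqI:
  assumes "p \<in> config_space V" "q \<in> config_space V"
    "\<And>v. v \<in> V \<Longrightarrow> Poly_Mapping.lookup p v = Poly_Mapping.lookup q v"
  shows "p = q"
  using assms by (intro poly_mapping_eqI) (metis (no_types, lifting) config_space_def in_keys_iff mem_Collect_eq subsetD)

lemma bounded_linear_config_of:
  assumes "\<And>v. v \<in> V \<Longrightarrow> bounded_linear (\<lambda>q. f q v)"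
  shows "bounded_linear (\<lambda>q. config_of V (f q))"
  unfolding config_of_def
  using assms by (intro bounded_linear_sum bounded_linear_compose[OF bounded_linear_single])

lemma subspace_config_space: "subspace (config_space V)"
  by (rule subspaceI) (auto simp: config_space_def in_keys_iff lookup_add subset_iff, metis add_0)

lemma config_space_finite_span:
  fixes b :: "nat \<Rightarrow> 'a::real_normed_vector"
  assumes "is_basis b d" "finite V"
  obtains W :: "('v \<Rightarrow>\<^sub>0 'a) set" where "finite W" "config_space V \<subseteq> span W"
proof
  let ?W = "(\<lambda>(v, i). Poly_Mapping.single v (b i)) ` (V \<times> {1..d})"
  show "finite ?W" using assms(2) by simp
  show "config_space V \<subseteq> span ?W"
  proof
    fix p :: "'v \<Rightarrow>\<^sub>0 'a" assume "p \<in> config_space V"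
    have "Poly_Mapping.single v (Poly_Mapping.lookup p v) \<in> span ?W" if "v \<in> V" for v
    proof -
      have lin: "linear (Poly_Mapping.single v :: 'a \<Rightarrow> _)"
        by (rule bounded_linear.linear[OF bounded_linear_single])
      have "Poly_Mapping.single v (Poly_Mapping.lookup p v) =
          (\<Sum>i=1..d. basis_coord b d (Poly_Mapping.lookup p v) i *\<^sub>R Poly_Mapping.single v (b i))"
        unfolding linear_scale[OF lin, symmetric] linear_sum[OF lin, symmetric]
          basis_coord_sum[OF assms(1)] ..
      also have "\<dots> \<in> span ?W"
        using that by (intro span_sum span_scale span_base) auto
      finally show ?thesis .
    qed
    then have "config_of V (Poly_Mapping.lookup p) \<in> span ?W"
      unfolding config_of_def by (rule span_sum)
    then show "p \<in> span ?W"
      using \<open>p \<in> _\<close> assms(2) by (simp add: config_of_lookup)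
  qed
qed

section \<open>Tangent vectors as velocities of curves\<close>

lemma tangent_spaceI:
  assumes "\<epsilon> > 0" "\<And>t. \<bar>t\<bar> < \<epsilon> \<Longrightarrow> (\<gamma> has_vector_derivative D t) (at t)"
    "continuous_on {-\<epsilon><..<\<epsilon>} D" "\<And>t. \<bar>t\<bar> < \<epsilon> \<Longrightarrow> \<gamma> t \<in> M" "\<gamma> 0 = x" "D 0 = v"
  shows "v \<in> tangent_space M x"
proof -
  have "\<gamma> C1_differentiable_on {-\<epsilon><..<\<epsilon>}"
    unfolding C1_differentiable_on_def using assms(2,3) by (intro exI[of _ D]) auto
  moreover have "vector_derivative \<gamma> (at 0) = v"
    using assms(1,2,6) by (intro vector_derivative_at) force
  ultimately show ?thesis
    unfolding tangent_space_def mem_Collect_eq using assms(1,4,5)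
    by (intro exI[of _ \<gamma>] conjI exI[of _ \<epsilon>]) auto
qed

lemma tangent_spaceE:
  assumes "v \<in> tangent_space M x"
  obtains \<gamma> D \<epsilon> where "\<epsilon> > 0" "\<And>t. \<bar>t\<bar> < \<epsilon> \<Longrightarrow> (\<gamma> has_vector_derivative D t) (at t)"
    "continuous_on {-\<epsilon><..<\<epsilon>} D" "\<And>t. \<bar>t\<bar> < \<epsilon> \<Longrightarrow> \<gamma> t \<in> M" "\<gamma> 0 = x" "D 0 = v"
proof -
  obtain \<gamma> \<epsilon> where \<epsilon>: "\<epsilon> > 0" and C1: "\<gamma> C1_differentiable_on {-\<epsilon><..<\<epsilon>}"
    and \<gamma>: "\<gamma> ` {-\<epsilon><..<\<epsilon>} \<subseteq> M" "\<gamma> 0 = x" and v: "v = vector_derivative \<gamma> (at 0)"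
    using assms unfolding tangent_space_def by blast
  obtain D where D: "\<And>t. t \<in> {-\<epsilon><..<\<epsilon>} \<Longrightarrow> (\<gamma> has_vector_derivative D t) (at t)"
    and cont: "continuous_on {-\<epsilon><..<\<epsilon>} D"
    using C1 unfolding C1_differentiable_on_def by blast
  have mem: "t \<in> {-\<epsilon><..<\<epsilon>} \<longleftrightarrow> \<bar>t\<bar> < \<epsilon>" for t by auto
  have "D 0 = v"
    using D[of 0] \<epsilon> by (simp add: v vector_derivative_at)
  with \<epsilon> D cont \<gamma> show ?thesis
    by (intro that[of \<epsilon> \<gamma> D]) (simp_all add: image_subset_iff mem del: greaterThanLessThan_iff)
qed

lemma tangent_space_mapsto:
  assumes L: "bounded_linear L" and sub: "L ` M \<subseteq> N" and v: "v \<in> tangent_space M x"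
  shows "L v \<in> tangent_space N (L x)"
proof (rule tangent_spaceE[OF v])
  fix \<gamma> D and \<epsilon> :: real
  assume "\<epsilon> > 0" and D: "\<And>t. \<bar>t\<bar> < \<epsilon> \<Longrightarrow> (\<gamma> has_vector_derivative D t) (at t)"
    and cont: "continuous_on {-\<epsilon><..<\<epsilon>} D" and \<gamma>: "\<And>t. \<bar>t\<bar> < \<epsilon> \<Longrightarrow> \<gamma> t \<in> M" "\<gamma> 0 = x" "D 0 = v"
  then show ?thesis
    using sub bounded_linear.has_vector_derivative[OF L D] bounded_linear.continuous_on[OF L cont]
    by (intro tangent_spaceI[of \<epsilon> "\<lambda>t. L (\<gamma> t)" "\<lambda>t. L (D t)"]) auto
qed

text \<open>Turns what all configurations of an orbit share, such as two coinciding points or zeros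
  outside \<open>V\<close>, into a property of the velocities.\<close>

lemma tangent_space_kernel:
  assumes L: "bounded_linear L" and const: "\<And>y. y \<in> M \<Longrightarrow> L y = c" and v: "v \<in> tangent_space M x"
  shows "L v = 0"
proof (rule tangent_spaceE[OF v])
  fix \<gamma> D and \<epsilon> :: real
  assume \<epsilon>: "\<epsilon> > 0" and D: "\<And>t. \<bar>t\<bar> < \<epsilon> \<Longrightarrow> (\<gamma> has_vector_derivative D t) (at t)"
    and \<gamma>: "\<And>t. \<bar>t\<bar> < \<epsilon> \<Longrightarrow> \<gamma> t \<in> M" and D0: "D 0 = v"
  have "((\<lambda>_. c) has_vector_derivative 0) (at 0)" by simp
  then have "((\<lambda>t. L (\<gamma> t)) has_vector_derivative 0) (at 0)"
    by (rule has_vector_derivative_transform_within_open[of _ _ _ "{-\<epsilon><..<\<epsilon>}"])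
      (use \<epsilon> \<gamma> const in \<open>auto simp: abs_less_iff minus_less_iff\<close>)
  moreover have "((\<lambda>t. L (\<gamma> t)) has_vector_derivative L v) (at 0)"
    using bounded_linear.has_vector_derivative[OF L D, of 0] \<epsilon> D0 by simp
  ultimately show ?thesis
    by (metis vector_derivative_at)
qed

lemma tangent_space_orbit_subset:
  "tangent_space (isometry_orbit V p) p \<subseteq> config_space V"
proof
  fix m assume m: "m \<in> tangent_space (isometry_orbit V p) p"
  have "Poly_Mapping.lookup m v = 0" if "v \<notin> V" for v
    by (rule tangent_space_kernel[OF bounded_linear_lookup _ m])
      (use that in \<open>auto simp: isometry_orbit_def config_space_def in_keys_iff\<close>)
  then show "m \<in> config_space V"
    by (auto simp: config_space_def in_keys_iff)
qed

definition translation_motion :: "'v set \<Rightarrow> 'a::real_normed_vector \<Rightarrow> ('v \<Rightarrow>\<^sub>0 'a)" where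
  "translation_motion V x = config_of V (\<lambda>_. x)"

lemma bounded_linear_translation_motion: "bounded_linear (translation_motion V)"
  unfolding translation_motion_def by (intro bounded_linear_config_of bounded_linear_ident)

lemma translation_motion_in_tangent_space:
  assumes "finite V" "p \<in> config_space V"
  shows "translation_motion V x \<in> tangent_space (isometry_orbit V p) p"
proof -
  define \<gamma> where "\<gamma> t = p + t *\<^sub>R translation_motion V x" for t :: real
  have D: "(\<gamma> has_vector_derivative translation_motion V x) (at t)" for t
    unfolding \<gamma>_def by (auto intro!: derivative_eq_intros)
  have "\<gamma> t \<in> isometry_orbit V p" for t
  proof -
    have "\<gamma> t \<in> config_space V"
      unfolding \<gamma>_def translation_motion_def
      using assms by (intro subspace_add subspace_scale subspace_config_space config_of_in_config_space)
    \<comment> \<open>The isometry in \<open>isometry_orbit\<close> takes the moved configuration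
      back to p, hence the minus sign below.\<close>
    then show ?thesis
      unfolding isometry_orbit_def
      by (auto intro!: exI[of _ "\<lambda>y. y - t *\<^sub>R x"]
          simp: \<gamma>_def dist_norm lookup_add translation_motion_def lookup_config_of assms)
  qed
  moreover have "\<gamma> 0 = p" by (simp add: \<gamma>_def)
  ultimately show ?thesis
    using D by (intro tangent_spaceI[of 1 \<gamma> "\<lambda>_. translation_motion V x"]) auto
qed

lemma translation_motion_basis:
  fixes b :: "nat \<Rightarrow> 'a::real_normed_vector"
  assumes "is_basis b d" "finite V" "V \<noteq> {}"
  shows "independent (translation_motion V ` b ` {1..d})"
    and "card (translation_motion V ` b ` {1..d}) = d"
    and "span (translation_motion V ` b ` {1..d}) = range (translation_motion V)"
proof -
  have lin: "linear (translation_motion V :: 'a \<Rightarrow> _)"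
    by (rule bounded_linear.linear[OF bounded_linear_translation_motion])
  obtain v where v: "v \<in> V" using assms(3) by blast
  have inj: "inj (translation_motion V :: 'a \<Rightarrow> _)"
  proof (rule injI)
    fix x y :: 'a assume "translation_motion V x = translation_motion V y"
    from arg_cong[OF this, of "\<lambda>q. Poly_Mapping.lookup q v"] show "x = y"
      using v assms(2) by (simp add: translation_motion_def lookup_config_of)
  qed
  have basis: "inj_on b {1..d}" "independent (b ` {1..d})" "span (b ` {1..d}) = UNIV"
    using assms(1) by (auto simp: is_basis_def)
  show "independent (translation_motion V ` b ` {1..d})"
    by (rule linear_independent_injective_image[OF lin basis(2)]) (rule inj_on_subset[OF inj], simp)
  show "card (translation_motion V ` b ` {1..d}) = d"
    using basis(1) inj by (simp add: card_image inj_on_subset[OF inj])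
  show "span (translation_motion V ` b ` {1..d}) = range (translation_motion V)"
    unfolding linear_span_image[OF lin] basis(3) ..
qed

lemma dim_translation_motions:
  fixes b :: "nat \<Rightarrow> 'a::real_normed_vector"
  assumes "is_basis b d" "finite V" "V \<noteq> {}"
  shows "dim (range (translation_motion V :: 'a \<Rightarrow> _)) = d"
  using translation_motion_basis[OF assms] real_vector.dim_span_eq_card_independent by metis

text \<open>Used in the contrapositive: dimension d leaves room for translations only.\<close>

lemma dim_gt_translation_motions:
  fixes b :: "nat \<Rightarrow> 'a::real_normed_vector" and m :: "'v \<Rightarrow>\<^sub>0 'a"
  assumes b: "is_basis b d" and V: "finite V" "V \<noteq> {}"
    and T: "range (translation_motion V) \<subseteq> T" "T \<subseteq> config_space V"
    and m: "m \<in> T" "m \<notin> range (translation_motion V)"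
  shows "d < dim T"
proof -
  let ?B = "translation_motion V ` b ` {1..d}"
  note B = translation_motion_basis[OF b V]
  have "independent (insert m ?B)"
    using B(1,3) m(2) by (intro real_vector.independent_insertI) auto
  moreover have "insert m ?B \<subseteq> T" using m(1) T(1) by auto
  moreover obtain W :: "('v \<Rightarrow>\<^sub>0 'a) set" where "finite W" "config_space V \<subseteq> span W"
    using config_space_finite_span[OF b V(1)] by blast
  ultimately have "card (insert m ?B) \<le> dim T"
    using card_independent_le_dim T(2) by blast
  moreover have "m \<notin> ?B" using B(3) m(2) span_superset[of ?B] by auto
  ultimately show ?thesis using B(2) by simp
qed

text \<open>If some framework had a trivial motion with different velocities at the ends of a segment, then placing
  \<open>V(H)\<close> on the line of that segment would give a placement of \<open>H\<close> with more than \<open>d\<close>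
  independent trivial motions. Isometries preserve lines, so the motion of the segment extends to
  the line without lifting it to the isometry group.\<close>

lemma tangent_space_orbit_eq_translations:
  fixes b :: "nat \<Rightarrow> 'a::real_normed_vector" and H :: "'v graph" and p :: "'w \<Rightarrow>\<^sub>0 'a"
  assumes b: "is_basis b d" and H: "finite_simple_graph H"
    and a12: "a1 \<in> verts H" "a2 \<in> verts H" "a1 \<noteq> a2"
    and dimH: "\<And>r :: 'v \<Rightarrow>\<^sub>0 'a. placement H r \<Longrightarrow> dim (trivial_motions H r) = d"
    and V: "finite V" "V \<noteq> {}" and p: "p \<in> config_space V"
  shows "tangent_space (isometry_orbit V p) p = range (translation_motion V)"
proof
  show "range (translation_motion V) \<subseteq> tangent_space (isometry_orbit V p) p"
    using translation_motion_in_tangent_space[OF V(1) p] by blast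
  have same: "Poly_Mapping.lookup m v = Poly_Mapping.lookup m w"
    if m: "m \<in> tangent_space (isometry_orbit V p) p" and vw: "v \<in> V" "w \<in> V" for m v w
  proof (rule ccontr)
    assume ne: "Poly_Mapping.lookup m v \<noteq> Poly_Mapping.lookup m w"
    have finH: "finite (verts H)" using H by (simp add: finite_simple_graph_def)
    \<comment> \<open>Vertex u of \<open>H\<close> will sit at \<open>c u\<close> times the
      difference of the two points, on a line through 0; injectivity keeps the vertices
      apart.\<close>
    obtain c :: "'v \<Rightarrow> nat" where c: "inj_on c (verts H)"
      using finite_imp_inj_to_nat_seg[OF finH] by blast
    define \<delta> :: "('w \<Rightarrow>\<^sub>0 'a) \<Rightarrow> 'a" where "\<delta> q = Poly_Mapping.lookup q v - Poly_Mapping.lookup q w" for q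
    define L where "L q = config_of (verts H) (\<lambda>u. real (c u) *\<^sub>R \<delta> q)" for q
    have bl_\<delta>: "bounded_linear \<delta>"
      unfolding \<delta>_def by (intro bounded_linear_sub bounded_linear_lookup)
    have bl_L: "bounded_linear L"
      unfolding L_def by (intro bounded_linear_config_of bounded_linear_const_scaleR bl_\<delta>)
    have lookup_L: "Poly_Mapping.lookup (L q) u = real (c u) *\<^sub>R \<delta> q" if "u \<in> verts H" for q u
      using that finH by (simp add: L_def lookup_config_of)
    \<comment> \<open>Points that coincide in p coincide throughout the orbit, so their velocities
      would agree.\<close>
    have "\<delta> p \<noteq> 0"
    proof
      assume "\<delta> p = 0"
      have "\<delta> q = 0" if "q \<in> isometry_orbit V p" for q
      proof -
        obtain T where T: "\<And>x y. dist (T x) (T y) = dist x (y::'a)"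
          "\<And>v. v \<in> V \<Longrightarrow> Poly_Mapping.lookup p v = T (Poly_Mapping.lookup q v)"
          using \<open>q \<in> _\<close> unfolding isometry_orbit_def by auto
        have "T (Poly_Mapping.lookup q v) = T (Poly_Mapping.lookup q w)"
          using T(2) vw \<open>\<delta> p = 0\<close> by (simp add: \<delta>_def)
        then show ?thesis
          using T(1)[of "Poly_Mapping.lookup q v" "Poly_Mapping.lookup q w"] by (simp add: \<delta>_def)
      qed
      from tangent_space_kernel[OF bl_\<delta> this m] have "\<delta> m = 0" .
      with ne show False by (simp add: \<delta>_def)
    qed
    have Lp: "L p \<in> config_space (verts H)"
      unfolding L_def by (rule config_of_in_config_space[OF finH])
    have "placement H (L p)"
      unfolding placement_def
    proof (intro conjI allI impI)
      show "L p \<in> config_space (verts H)" by (rule Lp)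
      fix x y assume "{x, y} \<in> edges H"
      then have xy: "{x, y} \<subseteq> verts H" "card {x, y} = 2"
        using H unfolding finite_simple_graph_def by blast+
      then have "x \<noteq> y" by auto
      with xy c have "c x \<noteq> c y" by (auto simp: inj_on_def)
      with xy \<open>\<delta> p \<noteq> 0\<close> show "Poly_Mapping.lookup (L p) x \<noteq> Poly_Mapping.lookup (L p) y"
        by (simp add: lookup_L)
    qed
    then have "dim (trivial_motions H (L p)) = d" by (rule dimH)
    have "L ` isometry_orbit V p \<subseteq> isometry_orbit (verts H) (L p)"
    proof (rule image_subsetI)
      fix q assume "q \<in> isometry_orbit V p"
      then obtain T where T: "\<And>x y. dist (T x) (T y) = dist x (y::'a)"
        "\<And>v. v \<in> V \<Longrightarrow> Poly_Mapping.lookup p v = T (Poly_Mapping.lookup q v)"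
        unfolding isometry_orbit_def by auto
      \<comment> \<open>\<open>T\<close> between two translations, arranged so that 0 is fixed; it
        then maps multiples of \<open>\<delta> q\<close> to the same multiples of
        \<open>\<delta> p\<close>.\<close>
      define S where "S y = T (y + Poly_Mapping.lookup q w) - Poly_Mapping.lookup p w" for y
      have "dist (S x) (S y) = dist x y" for x y
        using T(1)[of "x + Poly_Mapping.lookup q w" "y + Poly_Mapping.lookup q w"]
        by (simp add: S_def dist_norm)
      moreover have "S (s *\<^sub>R \<delta> q) = s *\<^sub>R \<delta> p" for s
        using is_basis_isometry_line[OF b T(1), of "Poly_Mapping.lookup q w" s "Poly_Mapping.lookup q v"]
        by (simp add: S_def \<delta>_def T(2) vw add.commute)
      moreover have "L q \<in> config_space (verts H)"
        unfolding L_def by (rule config_of_in_config_space[OF finH])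
      ultimately show "L q \<in> isometry_orbit (verts H) (L p)"
        unfolding isometry_orbit_def by (auto simp: lookup_L intro!: exI[of _ S])
    qed
    then have "L m \<in> trivial_motions H (L p)"
      unfolding trivial_motions_def using m by (intro tangent_space_mapsto[OF bl_L])
    \<comment> \<open>The velocities of \<open>L m\<close> at \<open>a1\<close> and
      \<open>a2\<close> are different multiples of the nonzero vector \<open>\<delta> m\<close>,
      whereas a translation moves all vertices equally.\<close>
    moreover have "L m \<notin> range (translation_motion (verts H))"
    proof
      assume "L m \<in> range (translation_motion (verts H))"
      then have "Poly_Mapping.lookup (L m) a1 = Poly_Mapping.lookup (L m) a2"
        using a12 finH by (auto simp: translation_motion_def lookup_config_of)
      then have "c a1 = c a2" using ne a12 by (simp add: lookup_L \<delta>_def)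
      then show False using c a12 by (simp add: inj_on_def)
    qed
    ultimately have "d < dim (trivial_motions H (L p))"
      using a12 translation_motion_in_tangent_space[OF finH Lp]
        tangent_space_orbit_subset[of "verts H" "L p"]
      by (intro dim_gt_translation_motions[OF b finH]) (auto simp: trivial_motions_def)
    with \<open>dim _ = d\<close> show False by simp
  qed
  obtain v where v: "v \<in> V" using V(2) by blast
  show "tangent_space (isometry_orbit V p) p \<subseteq> range (translation_motion V)"
  proof
    fix m assume m: "m \<in> tangent_space (isometry_orbit V p) p"
    have "m = translation_motion V (Poly_Mapping.lookup m v)"
    proof (rule config_space_eqI)
      show "m \<in> config_space V" using m tangent_space_orbit_subset by blast
      show "translation_motion V (Poly_Mapping.lookup m v) \<in> config_space V"
        unfolding translation_motion_def by (rule config_of_in_config_space[OF V(1)])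
      show "Poly_Mapping.lookup m u = Poly_Mapping.lookup (translation_motion V (Poly_Mapping.lookup m v)) u"
        if "u \<in> V" for u
        using same[OF m that v] that V(1) by (simp add: translation_motion_def lookup_config_of)
    qed
    then show "m \<in> range (translation_motion V)" by blast
  qed
qed

text \<open>Pulling back along the surjection \<pi> is injective on configurations and maps orbits
  into orbits with the same isometry. Applied to a bijection and to its inverse, it gives equal
  dimensions.\<close>

lemma dim_tangent_space_orbit_relabel_le:
  fixes b :: "nat \<Rightarrow> 'a::real_normed_vector" and p :: "'v \<Rightarrow>\<^sub>0 'a"
    and \<pi> :: "'w \<Rightarrow> 'v"
  assumes b: "is_basis b d" and V: "finite V" "finite V'" and \<pi>: "\<pi> ` V' = V"
    and p: "p \<in> config_space V"
  shows "dim (tangent_space (isometry_orbit V p) p) \<le>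
    dim (tangent_space (isometry_orbit V' (config_of V' (\<lambda>u. Poly_Mapping.lookup p (\<pi> u))))
      (config_of V' (\<lambda>u. Poly_Mapping.lookup p (\<pi> u))))"
proof -
  define L where "L q = config_of V' (\<lambda>u. Poly_Mapping.lookup q (\<pi> u))" for q :: "'v \<Rightarrow>\<^sub>0 'a"
  define T T' where "T = tangent_space (isometry_orbit V p) p"
    and "T' = tangent_space (isometry_orbit V' (L p)) (L p)"
  have bl_L: "bounded_linear L"
    unfolding L_def by (intro bounded_linear_config_of bounded_linear_lookup)
  have lookup_L: "Poly_Mapping.lookup (L q) u = Poly_Mapping.lookup q (\<pi> u)" if "u \<in> V'" for q u
    using that V(2) by (simp add: L_def lookup_config_of)
  have L_config: "L q \<in> config_space V'" for q
    unfolding L_def by (rule config_of_in_config_space[OF V(2)])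
  have "L ` isometry_orbit V p \<subseteq> isometry_orbit V' (L p)"
    using \<pi> by (fastforce simp: isometry_orbit_def lookup_L L_config)
  then have LT: "L ` T \<subseteq> T'"
    unfolding T_def T'_def using tangent_space_mapsto[OF bl_L] by blast
  obtain B where B: "B \<subseteq> T" "independent B" "T \<subseteq> span B" "card B = dim T"
    using real_vector.basis_exists[of T] by blast
  \<comment> \<open>The tangent space is just a set of velocities, not known here to be a subspace.
    Injectivity of \<open>L\<close> is therefore established on a subspace that contains
    \<open>span B\<close>.\<close>
  have "span B \<subseteq> config_space V"
    using B(1) tangent_space_orbit_subset[of V p]
    by (intro span_minimal subspace_config_space) (auto simp: T_def)
  moreover have "inj_on L (config_space V)"
  proof (rule inj_onI)
    fix q q' assume q: "q \<in> config_space V" "q' \<in> config_space V" "L q = L q'"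
    show "q = q'"
    proof (rule config_space_eqI[OF q(1,2)])
      fix v assume "v \<in> V"
      then obtain u where "u \<in> V'" "v = \<pi> u" using \<pi> by blast
      then show "Poly_Mapping.lookup q v = Poly_Mapping.lookup q' v"
        using lookup_L[of u q] lookup_L[of u q'] q(3) by simp
    qed
  qed
  ultimately have inj: "inj_on L (span B)" by (rule inj_on_subset[rotated])
  then have "independent (L ` B)"
    by (rule linear_independent_injective_image[OF bounded_linear.linear[OF bl_L] B(2)])
  moreover have "T' \<subseteq> config_space V'"
    unfolding T'_def by (rule tangent_space_orbit_subset)
  moreover obtain W :: "('w \<Rightarrow>\<^sub>0 'a) set" where "finite W" "config_space V' \<subseteq> span W"
    using config_space_finite_span[OF b V(2)] by blast
  moreover have "L ` B \<subseteq> T'"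
    using B(1) LT by blast
  ultimately have "card (L ` B) \<le> dim T'"
    by (meson card_independent_le_dim order_trans)
  moreover have "card (L ` B) = card B"
    using inj span_superset by (intro card_image inj_on_subset[OF inj]) auto
  ultimately show ?thesis
    using B(4) by (simp add: T_def T'_def L_def)
qed

subsection \<open>Independent families and rigidity matrices\<close>

text \<open>\<open>dim\<close> sees only the set of values, so reaching \<open>card I\<close> also
  excludes repetitions, which count as dependence of the family.\<close>

lemma independent_family_iff_dim:
  assumes "finite I"
  shows "(\<forall>c. (\<Sum>i\<in>I. c i *\<^sub>R f i) = 0 \<longrightarrow> (\<forall>i\<in>I. c i = 0)) \<longleftrightarrow> dim (f ` I) = card I"
proof
  assume *: "\<forall>c. (\<Sum>i\<in>I. c i *\<^sub>R f i) = 0 \<longrightarrow> (\<forall>i\<in>I. c i = 0)"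
  have inj: "inj_on f I"
  proof (rule inj_onI, rule ccontr)
    fix i j assume ij: "i \<in> I" "j \<in> I" "f i = f j" "i \<noteq> j"
    define c :: "'a \<Rightarrow> real" where "c k = (if k = i then 1 else 0) - (if k = j then 1 else 0)" for k
    have "(\<Sum>k\<in>I. c k *\<^sub>R f k) = (\<Sum>k\<in>I. if k = i then f k else 0) - (\<Sum>k\<in>I. if k = j then f k else 0)"
      unfolding sum_subtractf[symmetric] by (rule sum.cong) (auto simp: c_def)
    also have "\<dots> = 0" using ij assms by simp
    finally have "c i = 0" using * ij(1) by blast
    then show False using ij(4) by (simp add: c_def)
  qed
  have "independent (f ` I)"
  proof (rule real_vector.independent_if_scalars_zero)
    fix g y assume sum0: "(\<Sum>y\<in>f ` I. g y *\<^sub>R y) = 0" and y: "y \<in> f ` I"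
    have "(\<Sum>i\<in>I. g (f i) *\<^sub>R f i) = 0"
      using sum0 by (simp add: sum.reindex[OF inj])
    then have "\<forall>i\<in>I. g (f i) = 0"
      using spec[OF *, of "\<lambda>i. g (f i)"] by (rule rev_mp)
    then show "g y = 0" using y by blast
  qed (use assms in simp)
  then show "dim (f ` I) = card I"
    by (simp add: real_vector.dim_eq_card_independent card_image[OF inj])
next
  assume *: "dim (f ` I) = card I"
  have "card I \<le> card (f ` I)"
    unfolding *[symmetric] using assms by (intro real_vector.dim_le_card) (auto intro: span_base)
  then have card: "card (f ` I) = card I"
    using card_image_le[OF assms, of f] by simp
  then have inj: "inj_on f I" using assms by (simp add: eq_card_imp_inj_on)
  have "independent (f ` I)"
  proof (rule ccontr)
    assume "\<not> independent (f ` I)"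
    then obtain a where a: "a \<in> f ` I" "a \<in> span (f ` I - {a})"
      unfolding dependent_def by blast
    then have "f ` I \<subseteq> span (f ` I - {a})"
      by (metis insert_Diff insert_subset span_superset)
    then have "dim (f ` I) \<le> card (f ` I - {a})"
      using assms by (intro real_vector.dim_le_card) auto
    also have "\<dots> < card (f ` I)"
      using a(1) assms by (intro card_Diff1_less) auto
    finally show False using * card by simp
  qed
  then show "\<forall>c. (\<Sum>i\<in>I. c i *\<^sub>R f i) = 0 \<longrightarrow> (\<forall>i\<in>I. c i = 0)"
    using independent_family[OF assms inj] by blast
qed

text \<open>If each vector moves by less than half the constant of the lower bound, a combination
  changes by at most half of that bound and cannot vanish unless all coefficients do.\<close>

lemma independent_family_perturbation:
  fixes f :: "'i \<Rightarrow> 'b::real_normed_vector"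
  assumes fin: "finite I"
    and indep: "\<And>c. (\<Sum>i\<in>I. c i *\<^sub>R f i) = 0 \<Longrightarrow> \<forall>i\<in>I. c i = 0"
    and lim: "\<And>i. i \<in> I \<Longrightarrow> (g i \<longlongrightarrow> f i) F"
  shows "\<forall>\<^sub>F x in F. \<forall>c. (\<Sum>i\<in>I. c i *\<^sub>R g i x) = 0 \<longrightarrow> (\<forall>i\<in>I. c i = 0)"
proof -
  obtain \<delta> where \<delta>: "\<delta> > 0" "\<And>c. \<delta> * (\<Sum>i\<in>I. \<bar>c i\<bar>) \<le> norm (\<Sum>i\<in>I. c i *\<^sub>R f i)"
    using linear_combination_lower_bound[OF fin indep] by blast
  have "\<forall>\<^sub>F x in F. \<forall>i\<in>I. dist (g i x) (f i) < \<delta> / 2"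
    using fin lim \<delta>(1) by (intro eventually_ball_finite ballI tendstoD) auto
  then show ?thesis
  proof (rule eventually_mono, intro allI impI)
    fix x c assume close: "\<forall>i\<in>I. dist (g i x) (f i) < \<delta> / 2" and 0: "(\<Sum>i\<in>I. c i *\<^sub>R g i x) = 0"
    have "(\<Sum>i\<in>I. c i *\<^sub>R f i) = (\<Sum>i\<in>I. c i *\<^sub>R (f i - g i x))"
      using 0 by (simp add: scaleR_diff_right sum_subtractf)
    also have "norm \<dots> \<le> (\<Sum>i\<in>I. \<bar>c i\<bar> * (\<delta> / 2))"
    proof (rule sum_norm_le)
      fix i assume "i \<in> I"
      then have "norm (f i - g i x) \<le> \<delta> / 2"
        using close by (metis dist_commute dist_norm less_imp_le)
      then show "norm (c i *\<^sub>R (f i - g i x)) \<le> \<bar>c i\<bar> * (\<delta> / 2)"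
        unfolding norm_scaleR by (rule mult_left_mono) simp
    qed
    also have "\<dots> = \<delta> / 2 * (\<Sum>i\<in>I. \<bar>c i\<bar>)"
      unfolding sum_distrib_left by (intro sum.cong) simp_all
    finally have "\<delta> * (\<Sum>i\<in>I. \<bar>c i\<bar>) \<le> \<delta> / 2 * (\<Sum>i\<in>I. \<bar>c i\<bar>)"
      using \<delta>(2)[of c] by linarith
    then have "(\<Sum>i\<in>I. \<bar>c i\<bar>) \<le> 0"
      using \<delta>(1) by (simp add: field_simps)
    then have "(\<Sum>i\<in>I. \<bar>c i\<bar>) = 0"
      by (intro order_antisym sum_nonneg) auto
    then show "\<forall>i\<in>I. c i = 0"
      using fin by (simp add: sum_nonneg_eq_0_iff)
  qed
qed

lemma tendsto_poly_mapping:
  fixes f :: "'b \<Rightarrow> 'v \<Rightarrow>\<^sub>0 'a::real_normed_vector"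
  assumes A: "finite A" "\<And>x. Poly_Mapping.keys (f x) \<subseteq> A" "Poly_Mapping.keys l \<subseteq> A"
    and lim: "\<And>v. v \<in> A \<Longrightarrow> ((\<lambda>x. Poly_Mapping.lookup (f x) v) \<longlongrightarrow> Poly_Mapping.lookup l v) F"
  shows "(f \<longlongrightarrow> l) F"
proof (rule Lim_transform_eventually[THEN iffD2[OF Lim_null]])
  have "((\<lambda>x. \<Sum>v\<in>A. norm (Poly_Mapping.lookup (f x) v - Poly_Mapping.lookup l v)) \<longlongrightarrow>
      (\<Sum>v\<in>A. norm (Poly_Mapping.lookup l v - Poly_Mapping.lookup l v))) F"
    by (intro tendsto_intros lim)
  moreover have "norm (f x - l) = (\<Sum>v\<in>A. norm (Poly_Mapping.lookup (f x) v - Poly_Mapping.lookup l v))" for x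
    using norm_poly_mapping_eq_sum[OF A(1), of "f x - l"] A(2)[of x] A(3) keys_diff[of "f x" l]
    by (auto simp: lookup_minus)
  ultimately have "((\<lambda>x. norm (f x - l)) \<longlongrightarrow> 0) F" by simp
  then show "((\<lambda>x. f x - l) \<longlongrightarrow> 0) F" by (rule tendsto_norm_zero_cancel)
qed simp

section \<open>Rows of the rigidity matrix\<close>

lemma rigidity_matrix_edge:
  assumes "x \<noteq> y"
  shows "rigidity_matrix b p {x, y} (v, k) =
    (if v = x then support_functional (Poly_Mapping.lookup p x - Poly_Mapping.lookup p y) (b k)
     else if v = y then support_functional (Poly_Mapping.lookup p y - Poly_Mapping.lookup p x) (b k)
     else 0)"
proof -
  have "(THE w. {x, y} = {x, w}) = y" "(THE w. {x, y} = {y, w}) = x"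
    by (auto intro!: the_equality simp: doubleton_eq_iff)
  then show ?thesis by (simp add: rigidity_matrix_def)
qed

lemma lookup_rigidity_row:
  assumes "finite (verts G)"
  shows "Poly_Mapping.lookup (rigidity_row b d G p e) (v, k) =
    (if v \<in> verts G \<and> k \<in> {1..d} then rigidity_matrix b p e (v, k) else 0)"
proof -
  have "finite {c. (if c \<in> verts G \<times> {1..d} then rigidity_matrix b p e c else 0) \<noteq> 0}"
    by (rule finite_subset[of _ "verts G \<times> {1..d}"]) (use assms in auto)
  then show ?thesis by (simp add: rigidity_row_def)
qed

lemma rigidity_row_relation_iff:
  assumes "finite (verts G)"
  shows "(\<Sum>e\<in>E. c e *\<^sub>R rigidity_row b d G p e) = 0 \<longleftrightarrow>
    (\<forall>v\<in>verts G. \<forall>k\<in>{1..d}. (\<Sum>e\<in>E. c e * rigidity_matrix b p e (v, k)) = 0)"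
  (is "?S = 0 \<longleftrightarrow> ?R")
proof -
  have lookup: "Poly_Mapping.lookup ?S (v, k) =
      (if v \<in> verts G \<and> k \<in> {1..d} then \<Sum>e\<in>E. c e * rigidity_matrix b p e (v, k) else 0)" for v k
    by (cases "v \<in> verts G \<and> k \<in> {1..d}") (auto simp: lookup_sum lookup_rigidity_row[OF assms] simp del: One_nat_def intro!: sum.neutral)
  show ?thesis
  proof
    assume "?S = 0"
    then have "Poly_Mapping.lookup ?S (v, k) = 0" for v k by (simp only: lookup_zero)
    then show ?R unfolding lookup by metis
  next
    assume R: ?R
    have "Poly_Mapping.lookup ?S (v, k) = 0" for v k
      unfolding lookup using R by simp
    then show "?S = 0"
      by (intro poly_mapping_eqI) (simp only: lookup_zero split_paired_all)
  qed
qed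

lemma finite_simple_graph_edgeE:
  assumes "finite_simple_graph G" "e \<in> edges G"
  obtains x y where "e = {x, y}" "x \<noteq> y" "x \<in> verts G" "y \<in> verts G"
  using assms unfolding finite_simple_graph_def by (metis card_2_iff insert_subset)

lemma finite_simple_graph_finite_edges:
  assumes "finite_simple_graph G"
  shows "finite (edges G)"
  by (rule finite_subset[of _ "Pow (verts G)"]) (use assms in \<open>auto simp: finite_simple_graph_def\<close>)

lemma independent_framework_iff_rank:
  assumes "finite_simple_graph G"
  shows "independent_framework b d G p \<longleftrightarrow>
    well_positioned G p \<and> rigidity_rank b d G p = card (edges G)"
  unfolding independent_framework_def rigidity_rank_def
  unfolding independent_family_iff_dim[OF finite_simple_graph_finite_edges[OF assms]] ..

lemma rigidity_rank_le:
  assumes "finite_simple_graph G"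
  shows "rigidity_rank b d G p \<le> card (edges G)"
proof -
  have fin: "finite (edges G)" by (rule finite_simple_graph_finite_edges[OF assms])
  have "rigidity_rank b d G p \<le> card (rigidity_row b d G p ` edges G)"
    unfolding rigidity_rank_def using fin by (intro real_vector.dim_le_card) (auto intro: span_base)
  then show ?thesis using card_image_le[OF fin] order_trans by blast
qed

text \<open>An independent framework attains the largest conceivable rank, the number of edges, so
  regularity amounts to attaining it as well.\<close>

lemma regular_framework_iff_independent:
  assumes "finite_simple_graph G" "independent_graph b d G"
  shows "regular_framework b d G p \<longleftrightarrow> independent_framework b d G p"
proof -
  obtain q where "well_positioned G q" "rigidity_rank b d G q = card (edges G)"
    using assms unfolding independent_graph_def independent_framework_iff_rank[OF assms(1)] by blast
  moreover have "rigidity_rank b d G q \<le> card (edges G)" for q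
    by (rule rigidity_rank_le[OF assms(1)])
  ultimately show ?thesis
    unfolding regular_framework_def independent_framework_iff_rank[OF assms(1)]
    by (metis order_antisym)
qed

lemma rigid_framework_iff_independent:
  assumes "finite_simple_graph G" "independent_graph b d G"
  shows "rigid_framework b d G p \<longleftrightarrow> independent_framework b d G p \<and>
    int (card (edges G)) = int (d * card (verts G)) - int (dim (trivial_motions G p))"
  unfolding rigid_framework_def regular_framework_iff_independent[OF assms]
  using independent_framework_iff_rank[OF assms(1), of b d p] by auto

subsection \<open>Vertex substitution\<close>

locale vertex_substitution =
  fixes G H G' :: "'v graph" and v0 :: 'v and \<sigma> :: "'v \<Rightarrow> 'v"
  assumes graph_G: "finite_simple_graph G"
    and graph_H: "finite_simple_graph H"
    and v0: "v0 \<in> verts G"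
    and disjoint: "verts H \<inter> (verts G - {v0}) = {}"
    and \<sigma>: "{v0, w} \<in> edges G \<Longrightarrow> \<sigma> w \<in> verts H"
    and verts_eq: "verts G' = (verts G - {v0}) \<union> verts H"
    and edges_eq: "edges G' = {e \<in> edges G. v0 \<notin> e} \<union> edges H \<union> {{\<sigma> w, w} | w. {v0, w} \<in> edges G}"
begin

lemma finite_verts: "finite (verts G)" "finite (verts H)" "finite (verts G')"
  using graph_G graph_H by (simp_all add: finite_simple_graph_def verts_eq)

text \<open>The contraction of \<open>H\<close> that turns \<open>G'\<close> back into
  \<open>G\<close>. The vertex \<open>v0\<close> may itself belong to \<open>H\<close>; it is fixed
  in either case.\<close>

definition collapse :: "'v \<Rightarrow> 'v" where
  "collapse u = (if u \<in> verts H then v0 else u)"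

text \<open>All edges of \<open>G'\<close> that stem from \<open>G\<close>, including those that
  avoid \<open>v0\<close> and stay in place.\<close>

definition moved_edges :: "'v set set" where
  "moved_edges = {e \<in> edges G. v0 \<notin> e} \<union> {{\<sigma> w, w} | w. {v0, w} \<in> edges G}"

lemma edges_eq_Un: "edges G' = moved_edges \<union> edges H"
  unfolding edges_eq moved_edges_def by blast

lemma moved_edgeE:
  assumes "e \<in> moved_edges"
  obtains x y where "e = {x, y}" "collapse x \<noteq> collapse y" "x \<in> verts G'" "y \<in> verts G'"
    "{collapse x, collapse y} \<in> edges G"
proof (cases "e \<in> edges G \<and> v0 \<notin> e")
  case True
  then obtain x y where xy: "e = {x, y}" "x \<noteq> y" "x \<in> verts G - {v0}" "y \<in> verts G - {v0}"
    using finite_simple_graph_edgeE[OF graph_G] by (metis DiffI insertCI singletonD)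
  then have "collapse x = x" "collapse y = y"
    using disjoint by (auto simp: collapse_def)
  with that[of x y] xy True show ?thesis by (simp add: verts_eq)
next
  case False
  then obtain w where w: "e = {\<sigma> w, w}" "{v0, w} \<in> edges G"
    using assms by (auto simp: moved_edges_def)
  have "w \<noteq> v0" "w \<in> verts G"
    using w(2) graph_G by (auto simp: finite_simple_graph_def dest!: bspec)
  then have "collapse (\<sigma> w) = v0" "collapse w = w"
    using disjoint \<sigma>[OF w(2)] by (auto simp: collapse_def)
  with that[of "\<sigma> w" w] w \<open>w \<noteq> v0\<close> \<open>w \<in> verts G\<close> \<sigma>[OF w(2)] show ?thesis
    by (simp add: verts_eq)
qed

lemma edge_HE:
  assumes "e \<in> edges H"
  obtains x y where "e = {x, y}" "x \<noteq> y" "x \<in> verts H" "y \<in> verts H"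
    "collapse x = v0" "collapse y = v0" "x \<in> verts G'" "y \<in> verts G'"
  using finite_simple_graph_edgeE[OF graph_H assms] by (metis UnI2 collapse_def verts_eq)

text \<open>\<open>collapse\<close> separates the ends of a moved edge and identifies the ends of an
  edge of \<open>H\<close>.\<close>

lemma moved_edges_disjoint: "moved_edges \<inter> edges H = {}"
proof -
  have False if "e \<in> moved_edges" "e \<in> edges H" for e
    using moved_edgeE[OF that(1)] edge_HE[OF that(2)] by (metis doubleton_eq_iff)
  then show ?thesis by blast
qed

lemma collapse_image_moved:
  assumes "{v0, w} \<in> edges G"
  shows "collapse ` {\<sigma> w, w} = {v0, w}"
proof -
  have "w \<noteq> v0" "w \<in> verts G"
    using assms graph_G by (auto simp: finite_simple_graph_def dest!: bspec)
  then show ?thesis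
    using disjoint \<sigma>[OF assms] by (auto simp: collapse_def)
qed

lemma collapse_image_kept:
  assumes "e \<in> edges G" "v0 \<notin> e"
  shows "collapse ` e = e"
proof -
  have "e \<subseteq> verts G - {v0}"
    using assms graph_G by (auto simp: finite_simple_graph_def)
  then have "collapse u = u" if "u \<in> e" for u
    using that disjoint by (auto simp: collapse_def)
  then show ?thesis by simp
qed

text \<open>An edge is recovered from its image: if the image avoids \<open>v0\<close> nothing has
  moved, and otherwise its other end w determines the edge \<open>{\<sigma> w, w}\<close>. The
  bijection counts edges and carries coefficients of a row relation from \<open>G'\<close> to
  \<open>G\<close>.\<close>

lemma bij_betw_moved_edges: "bij_betw (\<lambda>e. collapse ` e) moved_edges (edges G)"
proof (rule bij_betw_imageI)
  show "inj_on (\<lambda>e. collapse ` e) moved_edges"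
  proof (rule inj_onI)
    fix e e' assume e: "e \<in> moved_edges" and e': "e' \<in> moved_edges"
      and eq: "collapse ` e = collapse ` e'"
    have cases: "v0 \<notin> collapse ` e \<and> e = collapse ` e \<or>
        (\<exists>w. collapse ` e = {v0, w} \<and> e = {\<sigma> w, w})" if "e \<in> moved_edges" for e
    proof -
      have "(e \<in> edges G \<and> v0 \<notin> e) \<or> (\<exists>w. e = {\<sigma> w, w} \<and> {v0, w} \<in> edges G)"
        using that by (auto simp: moved_edges_def)
      then show ?thesis
      proof (elim disjE exE conjE)
        assume "e \<in> edges G" "v0 \<notin> e"
        then show ?thesis by (simp add: collapse_image_kept)
      next
        fix w assume "e = {\<sigma> w, w}" "{v0, w} \<in> edges G"
        then show ?thesis using collapse_image_moved by blast
      qed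
    qed
    from cases[OF e] cases[OF e'] eq show "e = e'"
      by (auto simp only: doubleton_eq_iff insert_iff)
  qed
  show "(\<lambda>e. collapse ` e) ` moved_edges = edges G"
  proof (intro equalityI subsetI)
    fix e assume "e \<in> (\<lambda>e. collapse ` e) ` moved_edges"
    then obtain e' where "e' \<in> moved_edges" "e = collapse ` e'" by blast
    then show "e \<in> edges G"
      using moved_edgeE[of e'] by (metis image_insert image_empty)
  next
    fix e assume e: "e \<in> edges G"
    show "e \<in> (\<lambda>e. collapse ` e) ` moved_edges"
    proof (cases "v0 \<in> e")
      case True
      then obtain w where "e = {v0, w}"
        using finite_simple_graph_edgeE[OF graph_G e] by (metis insertE insert_commute singletonD)
      then show ?thesis
        using e collapse_image_moved[of w] unfolding moved_edges_def by blast
    next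
      case False
      then show ?thesis
        using e collapse_image_kept[of e] unfolding moved_edges_def by blast
    qed
  qed
qed

lemma finite_edges: "finite (edges G)" "finite (edges H)" "finite moved_edges"
  using finite_simple_graph_finite_edges[OF graph_G] finite_simple_graph_finite_edges[OF graph_H]
    bij_betw_finite[OF bij_betw_moved_edges] by auto

lemma finite_simple_graph_substitution: "finite_simple_graph G'"
  unfolding finite_simple_graph_def edges_eq_Un
proof (intro conjI ballI finite_verts(3))
  fix e assume "e \<in> moved_edges \<union> edges H"
  then obtain x y where "e = {x, y}" "x \<noteq> y" "x \<in> verts G'" "y \<in> verts G'"
    by (elim UnE moved_edgeE edge_HE) auto
  then show "e \<subseteq> verts G'" "card e = 2" by auto
qed

lemma card_edges_substitution: "card (edges G') = card (edges G) + card (edges H)"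
  using card_Un_disjoint[OF finite_edges(3,2) moved_edges_disjoint] bij_betw_same_card[OF bij_betw_moved_edges]
  by (simp add: edges_eq_Un)

lemma card_verts_substitution: "card (verts G') + 1 = card (verts G) + card (verts H)"
proof -
  have "card (verts G') = card (verts G - {v0}) + card (verts H)"
    unfolding verts_eq using finite_verts disjoint by (intro card_Un_disjoint) auto
  moreover have "card (verts G - {v0}) + 1 = card (verts G)"
    using v0 finite_verts(1) card_Suc_Diff1 by (metis Suc_eq_plus1)
  ultimately show ?thesis by simp
qed

lemma collapse_in_verts: "u \<in> verts G' \<Longrightarrow> collapse u \<in> verts G"
  using v0 by (auto simp: verts_eq collapse_def)

section \<open>The framework with a small copy of \<open>H\<close>\<close>

definition substituted_config ::
    "('v \<Rightarrow>\<^sub>0 'a::real_normed_vector) \<Rightarrow> ('v \<Rightarrow>\<^sub>0 'a) \<Rightarrow> real \<Rightarrow> ('v \<Rightarrow>\<^sub>0 'a)" where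
  "substituted_config p r \<epsilon> = config_of (verts G')
     (\<lambda>u. Poly_Mapping.lookup p (collapse u) + \<epsilon> *\<^sub>R Poly_Mapping.lookup r u)"

text \<open>A placement r of \<open>H\<close> is 0 outside the vertices of \<open>H\<close>, so this
  single formula leaves the other vertices at p.\<close>

lemma lookup_substituted_config:
  "u \<in> verts G' \<Longrightarrow> Poly_Mapping.lookup (substituted_config p r \<epsilon>) u =
    Poly_Mapping.lookup p (collapse u) + \<epsilon> *\<^sub>R Poly_Mapping.lookup r u"
  by (simp add: substituted_config_def lookup_config_of finite_verts)

text \<open>As \<open>\<epsilon>\<close> tends to \<open>0\<close>, the rows of the edges of \<open>H\<close>, divided by \<open>\<epsilon>\<close>, and the other rows of
  the substituted framework converge to these vectors.\<close>

definition limit_row :: "(nat \<Rightarrow> 'a::real_normed_vector) \<Rightarrow> ('v \<Rightarrow>\<^sub>0 'a) \<Rightarrow> ('v \<Rightarrow>\<^sub>0 'a) \<Rightarrow>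
    'v set \<Rightarrow> 'v \<times> nat \<Rightarrow> real" where
  "limit_row b p r e = (\<lambda>(u, k).
     if u \<notin> e then 0
     else if e \<in> edges H then rigidity_matrix b r e (u, k)
     else rigidity_matrix b p (collapse ` e) (collapse u, k))"

lemma limit_row_H:
  assumes "e \<in> edges H"
  shows "limit_row b p r e (u, k) = rigidity_matrix b r e (u, k)"
  using assms by (simp add: limit_row_def rigidity_matrix_def)

lemma limit_row_moved:
  assumes "e \<in> moved_edges"
  shows "limit_row b p r e (u, k) =
    (if u \<in> e then rigidity_matrix b p (collapse ` e) (collapse u, k) else 0)"
  using assms moved_edges_disjoint by (auto simp: limit_row_def)

text \<open>The ends of a moved edge lie in different fibres of \<open>collapse\<close>, so a fibre
  sum has at most one summand that can be nonzero.\<close>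

lemma sum_fibre_limit_row_moved:
  assumes "e \<in> moved_edges"
  shows "(\<Sum>u\<in>{u \<in> verts G'. collapse u = v}. limit_row b p r e (u, k)) =
    rigidity_matrix b p (collapse ` e) (v, k)"
proof -
  obtain x y where xy: "e = {x, y}" "collapse x \<noteq> collapse y" "x \<in> verts G'" "y \<in> verts G'"
    using moved_edgeE[OF assms] by metis
  let ?f = "\<lambda>u. rigidity_matrix b p (collapse ` e) (collapse u, k)"
  have "(\<Sum>u\<in>{u \<in> verts G'. collapse u = v}. limit_row b p r e (u, k)) =
      (\<Sum>u\<in>{u \<in> {x, y}. collapse u = v}. ?f u)"
    unfolding limit_row_moved[OF assms]
    by (rule sum.mono_neutral_cong_right) (use xy finite_verts in auto)
  also have "\<dots> = rigidity_matrix b p (collapse ` e) (v, k)"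
  proof -
    consider "collapse x = v" | "collapse y = v" | "collapse x \<noteq> v" "collapse y \<noteq> v" by blast
    then show ?thesis
    proof cases
      case 1
      then have "{u \<in> {x, y}. collapse u = v} = {x}" using xy(2) by auto
      with 1 show ?thesis by simp
    next
      case 2
      then have "{u \<in> {x, y}. collapse u = v} = {y}" using xy(2) by auto
      with 2 show ?thesis by simp
    next
      case 3
      then have "{u \<in> {x, y}. collapse u = v} = {}" by auto
      moreover have "rigidity_matrix b p (collapse ` e) (v, k) = 0"
        using 3 xy(1) by (simp add: rigidity_matrix_def)
      ultimately show ?thesis by simp
    qed
  qed
  finally show ?thesis .
qed

text \<open>Both ends lie in the fibre over \<open>v0\<close>, and their entries cancel because the
  support functional is odd in the point.\<close>

lemma sum_fibre_limit_row_H: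
  fixes b :: "nat \<Rightarrow> 'a::real_normed_vector"
  assumes b: "is_basis b d" and r: "well_positioned H r" and e: "e \<in> edges H"
  shows "(\<Sum>u\<in>{u \<in> verts G'. collapse u = v}. limit_row b p r e (u, k)) = 0"
proof -
  obtain x y where xy: "e = {x, y}" "x \<noteq> y" "collapse x = v0" "collapse y = v0"
    "x \<in> verts G'" "y \<in> verts G'"
    using edge_HE[OF e] by metis
  show ?thesis
  proof (cases "v = v0")
    case True
    have "smooth_point (Poly_Mapping.lookup r x - Poly_Mapping.lookup r y)"
      using r e xy(1) by (simp add: well_positioned_def)
    from is_basis_smooth_point_scaleR(2)[OF b this, of "-1"]
    have "support_functional (Poly_Mapping.lookup r y - Poly_Mapping.lookup r x) =
        (\<lambda>z. - support_functional (Poly_Mapping.lookup r x - Poly_Mapping.lookup r y) z)"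
      by simp
    then have "(\<Sum>u\<in>{x, y}. limit_row b p r e (u, k)) = 0"
      unfolding limit_row_H[OF e] unfolding xy(1) rigidity_matrix_edge[OF xy(2)] using xy(2) by simp
    moreover have "(\<Sum>u\<in>{u \<in> verts G'. collapse u = v}. limit_row b p r e (u, k)) =
        (\<Sum>u\<in>{x, y}. limit_row b p r e (u, k))"
      by (rule sum.mono_neutral_right) (use True xy finite_verts in \<open>auto simp: limit_row_def\<close>)
    ultimately show ?thesis by simp
  next
    case False
    have "limit_row b p r e (u, k) = 0" if "collapse u = v" for u
      using that False xy by (auto simp: limit_row_def)
    then show ?thesis by (intro sum.neutral) blast
  qed
qed

text \<open>The limit matrix is block triangular. Fibre sums of columns leave a relation among the
  rows of \<open>G\<close> at p, so c vanishes on the moved edges; the columns of \<open>H\<close>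
  then carry a relation among the rows of \<open>H\<close> at r alone.\<close>

lemma limit_rows_independent:
  fixes b :: "nat \<Rightarrow> 'a::real_normed_vector"
  assumes b: "is_basis b d"
    and p: "independent_framework b d G p" and r: "independent_framework b d H r"
    and 0: "\<And>u k. u \<in> verts G' \<Longrightarrow> k \<in> {1..d} \<Longrightarrow> (\<Sum>e\<in>edges G'. c e * limit_row b p r e (u, k)) = 0"
  shows "\<forall>e\<in>edges G'. c e = 0"
proof -
  have split: "(\<Sum>e\<in>edges G'. f e) = (\<Sum>e\<in>moved_edges. f e) + (\<Sum>e\<in>edges H. f e)" for f :: "_ \<Rightarrow> real"
    unfolding edges_eq_Un
    by (intro sum.union_disjoint finite_edges moved_edges_disjoint)
  have wpr: "well_positioned H r" using r by (simp add: independent_framework_def)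
  define \<rho> where "\<rho> = the_inv_into moved_edges (\<lambda>e. collapse ` e)"
  have \<rho>: "\<rho> (collapse ` e) = e" if "e \<in> moved_edges" for e
    unfolding \<rho>_def by (rule the_inv_into_f_f[OF bij_betw_imp_inj_on[OF bij_betw_moved_edges] that])
  have "(\<Sum>e\<in>edges G. c (\<rho> e) * rigidity_matrix b p e (v, k)) = 0"
    if "v \<in> verts G" "k \<in> {1..d}" for v k
  proof -
    let ?U = "{u \<in> verts G'. collapse u = v}"
    have "0 = (\<Sum>u\<in>?U. \<Sum>e\<in>edges G'. c e * limit_row b p r e (u, k))"
      using 0 that(2) by simp
    also have "\<dots> = (\<Sum>e\<in>edges G'. c e * (\<Sum>u\<in>?U. limit_row b p r e (u, k)))"
      by (subst sum.swap) (simp add: sum_distrib_left)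
    also have "\<dots> = (\<Sum>e\<in>moved_edges. c e * rigidity_matrix b p (collapse ` e) (v, k))"
      unfolding split by (simp add: sum_fibre_limit_row_H[OF b wpr] sum_fibre_limit_row_moved)
    also have "\<dots> = (\<Sum>e\<in>moved_edges. c (\<rho> (collapse ` e)) * rigidity_matrix b p (collapse ` e) (v, k))"
      by (simp add: \<rho>)
    also have "\<dots> = (\<Sum>e\<in>edges G. c (\<rho> e) * rigidity_matrix b p e (v, k))"
      by (rule sum.reindex_bij_betw[OF bij_betw_moved_edges])
    finally show ?thesis by simp
  qed
  then have "\<forall>e\<in>edges G. c (\<rho> e) = 0"
    using p unfolding independent_framework_def rigidity_row_relation_iff[OF finite_verts(1)]
    by (auto dest!: spec[of _ "\<lambda>e. c (\<rho> e)"])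
  then have c_moved: "c e = 0" if "e \<in> moved_edges" for e
    using \<rho>[OF that] bij_betw_apply[OF bij_betw_moved_edges that] by metis
  have "(\<Sum>e\<in>edges H. c e * rigidity_matrix b r e (u, k)) = 0" if "u \<in> verts H" "k \<in> {1..d}" for u k
    using 0[of u k] that unfolding split by (simp add: c_moved limit_row_H verts_eq)
  then have "\<forall>e\<in>edges H. c e = 0"
    using r unfolding independent_framework_def rigidity_row_relation_iff[OF finite_verts(2)]
    by blast
  with c_moved show ?thesis unfolding edges_eq_Un by blast
qed


lemma substituted_config_diff:
  assumes "x \<in> verts G'" "y \<in> verts G'"
  shows "Poly_Mapping.lookup (substituted_config p r \<epsilon>) x - Poly_Mapping.lookup (substituted_config p r \<epsilon>) y =
    (Poly_Mapping.lookup p (collapse x) - Poly_Mapping.lookup p (collapse y)) +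
    \<epsilon> *\<^sub>R (Poly_Mapping.lookup r x - Poly_Mapping.lookup r y)"
  using assms by (simp add: lookup_substituted_config scaleR_diff_right)

text \<open>Openness of the smooth points handles the moved edges, whose differences tend to smooth
  ones in p. Along an edge of \<open>H\<close> the difference tends to 0, which is not smooth, but
  it is a positive multiple of a smooth difference in r.\<close>

lemma eventually_well_positioned_substituted:
  fixes b :: "nat \<Rightarrow> 'a::real_normed_vector" and p r :: "'v \<Rightarrow>\<^sub>0 'a"
  assumes b: "is_basis b d" and smooth_open: "open {x :: 'a. smooth_point x}"
    and p: "well_positioned G p" and r: "well_positioned H r"
  shows "\<forall>\<^sub>F \<epsilon> in at_right 0. well_positioned G' (substituted_config p r \<epsilon>)"
proof -
  let ?q = "\<lambda>\<epsilon>. Poly_Mapping.lookup (substituted_config p r \<epsilon>)"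
  have "\<forall>\<^sub>F \<epsilon> in at_right 0. smooth_point (?q \<epsilon> x - ?q \<epsilon> y)" if e: "{x, y} \<in> edges G'" for x y
  proof -
    have xy: "x \<in> verts G'" "y \<in> verts G'"
      using e finite_simple_graph_substitution by (auto simp: finite_simple_graph_def)
    show ?thesis
    proof (cases "{x, y} \<in> edges H")
      case True
      then have "collapse x = collapse y"
        by (auto elim!: edge_HE simp: doubleton_eq_iff)
      moreover have "smooth_point (Poly_Mapping.lookup r x - Poly_Mapping.lookup r y)"
        using r True by (simp add: well_positioned_def)
      ultimately have "smooth_point (?q \<epsilon> x - ?q \<epsilon> y)" if "\<epsilon> > 0" for \<epsilon>
        using that is_basis_smooth_point_scaleR(1)[OF b] by (simp add: substituted_config_diff[OF xy])
      then show ?thesis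
        using eventually_at_right_less[of "0::real"] by (rule eventually_mono[rotated])
    next
      case False
      then have "{x, y} \<in> moved_edges" using e by (simp add: edges_eq_Un)
      then have "{collapse x, collapse y} \<in> edges G"
        using bij_betw_apply[OF bij_betw_moved_edges] by fastforce
      then have "smooth_point (Poly_Mapping.lookup p (collapse x) - Poly_Mapping.lookup p (collapse y))"
        using p by (simp add: well_positioned_def)
      moreover have "((\<lambda>\<epsilon>. ?q \<epsilon> x - ?q \<epsilon> y) \<longlongrightarrow>
          (Poly_Mapping.lookup p (collapse x) - Poly_Mapping.lookup p (collapse y)) +
          0 *\<^sub>R (Poly_Mapping.lookup r x - Poly_Mapping.lookup r y)) (at_right 0)"
        unfolding substituted_config_diff[OF xy] by (intro tendsto_intros)
      ultimately show ?thesis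
        using topological_tendstoD[OF _ smooth_open] by fastforce
    qed
  qed
  then have "\<forall>\<^sub>F \<epsilon> in at_right 0. \<forall>x\<in>verts G'. \<forall>y\<in>verts G'.
      {x, y} \<in> edges G' \<longrightarrow> smooth_point (?q \<epsilon> x - ?q \<epsilon> y)"
    by (intro eventually_ball_finite finite_verts ballI) (simp add: eventually_mono)
  then show ?thesis
  proof (rule eventually_mono)
    fix \<epsilon> :: real
    assume *: "\<forall>x\<in>verts G'. \<forall>y\<in>verts G'. {x, y} \<in> edges G' \<longrightarrow> smooth_point (?q \<epsilon> x - ?q \<epsilon> y)"
    have "smooth_point (?q \<epsilon> x - ?q \<epsilon> y)" if e: "{x, y} \<in> edges G'" for x y
    proof -
      have "x \<in> verts G'" "y \<in> verts G'"
        using e finite_simple_graph_substitution by (auto simp: finite_simple_graph_def)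
      with * e show ?thesis by blast
    qed
    moreover have "substituted_config p r \<epsilon> \<in> config_space (verts G')"
      unfolding substituted_config_def by (rule config_of_in_config_space[OF finite_verts(3)])
    ultimately show "well_positioned G' (substituted_config p r \<epsilon>)"
      unfolding well_positioned_def placement_def by (auto simp: smooth_point_def)
  qed
qed

text \<open>The contribution of p cancels along an edge of \<open>H\<close>, so the row scales
  exactly with \<epsilon>, and division by \<epsilon> already gives the limit row.\<close>

lemma rigidity_matrix_substituted_H:
  fixes b :: "nat \<Rightarrow> 'a::real_normed_vector"
  assumes b: "is_basis b d" and r: "well_positioned H r" and e: "e \<in> edges H" and \<epsilon>: "\<epsilon> > 0"
  shows "rigidity_matrix b (substituted_config p r \<epsilon>) e (u, k) = \<epsilon> * limit_row b p r e (u, k)"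
proof -
  obtain x y where xy: "e = {x, y}" "x \<noteq> y" "collapse x = collapse y" "x \<in> verts G'" "y \<in> verts G'"
    using edge_HE[OF e] by metis
  have smooth: "smooth_point (Poly_Mapping.lookup r x - Poly_Mapping.lookup r y)"
    "smooth_point (Poly_Mapping.lookup r y - Poly_Mapping.lookup r x)"
    using r e xy(1) by (auto simp: well_positioned_def insert_commute)
  have "\<epsilon> \<noteq> 0" using \<epsilon> by simp
  note scale = is_basis_smooth_point_scaleR(2)[OF b _ this]
  show ?thesis
    unfolding limit_row_H[OF e]
    unfolding xy(1) rigidity_matrix_edge[OF xy(2)] substituted_config_diff[OF xy(4,5)]
      substituted_config_diff[OF xy(5,4)]
    by (simp add: xy(3) scale smooth)
qed

lemma rigidity_matrix_substituted_moved_tendsto: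
  fixes b :: "nat \<Rightarrow> 'a::real_normed_vector"
  assumes b: "is_basis b d" and p: "well_positioned G p" and e: "e \<in> moved_edges"
    and wp: "\<And>n. well_positioned G' (substituted_config p r (\<epsilon> n))" and \<epsilon>: "\<epsilon> \<longlonglongrightarrow> 0"
  shows "(\<lambda>n. rigidity_matrix b (substituted_config p r (\<epsilon> n)) e (u, k)) \<longlonglongrightarrow> limit_row b p r e (u, k)"
proof -
  obtain x y where xy: "e = {x, y}" "collapse x \<noteq> collapse y" "x \<in> verts G'" "y \<in> verts G'"
    "{collapse x, collapse y} \<in> edges G"
    using moved_edgeE[OF e] by metis
  have "x \<noteq> y" using xy(2) by blast
  let ?q = "\<lambda>n. Poly_Mapping.lookup (substituted_config p r (\<epsilon> n))"
  have lim: "(\<lambda>n. support_functional (?q n v - ?q n w) (b k)) \<longlonglongrightarrow>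
      support_functional (Poly_Mapping.lookup p (collapse v) - Poly_Mapping.lookup p (collapse w)) (b k)"
    if vw: "{v, w} = {x, y}" for v w
  proof (rule is_basis_support_functional_tendsto[OF b])
    have v: "v \<in> verts G'" "w \<in> verts G'" using vw xy(3,4) by (auto simp: doubleton_eq_iff)
    have "(\<lambda>n. ?q n v - ?q n w) \<longlonglongrightarrow>
        (Poly_Mapping.lookup p (collapse v) - Poly_Mapping.lookup p (collapse w)) +
        0 *\<^sub>R (Poly_Mapping.lookup r v - Poly_Mapping.lookup r w)"
      unfolding substituted_config_diff[OF v] by (intro tendsto_intros \<epsilon>)
    then show "(\<lambda>n. ?q n v - ?q n w) \<longlonglongrightarrow>
        Poly_Mapping.lookup p (collapse v) - Poly_Mapping.lookup p (collapse w)"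
      by simp
    have "{v, w} \<in> edges G'" using e vw xy(1) by (simp add: edges_eq_Un)
    then show "smooth_point (?q n v - ?q n w)" for n
      using wp[of n] by (simp add: well_positioned_def)
    have "{collapse v, collapse w} \<in> edges G"
      using vw xy(5) by (auto simp: doubleton_eq_iff insert_commute)
    then show "smooth_point (Poly_Mapping.lookup p (collapse v) - Poly_Mapping.lookup p (collapse w))"
      using p by (simp add: well_positioned_def)
  qed
  consider "u = x" | "u = y" "u \<noteq> x" | "u \<notin> {x, y}" by blast
  then show ?thesis
  proof cases
    case 1
    then show ?thesis
      using lim[of x y] xy(2)
      unfolding limit_row_moved[OF e] unfolding xy(1) image_insert image_empty
        rigidity_matrix_edge[OF \<open>x \<noteq> y\<close>] rigidity_matrix_edge[OF xy(2)] by simp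
  next
    case 2
    then show ?thesis
      using lim[of y x] xy(2)
      unfolding limit_row_moved[OF e] unfolding xy(1) image_insert image_empty
        rigidity_matrix_edge[OF \<open>x \<noteq> y\<close>] rigidity_matrix_edge[OF xy(2)] by (simp add: insert_commute)
  next
    case 3
    then show ?thesis
      unfolding limit_row_moved[OF e] unfolding xy(1) rigidity_matrix_edge[OF \<open>x \<noteq> y\<close>] by simp
  qed
qed

lemma independent_framework_substituted:
  fixes b :: "nat \<Rightarrow> 'a::real_normed_vector" and p r :: "'v \<Rightarrow>\<^sub>0 'a"
  assumes b: "is_basis b d" and smooth_open: "open {x :: 'a. smooth_point x}"
    and p: "independent_framework b d G p" and r: "independent_framework b d H r"
  obtains \<epsilon> where "\<epsilon> > 0" "independent_framework b d G' (substituted_config p r \<epsilon>)"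
proof -
  have wp: "well_positioned G p" "well_positioned H r"
    using p r by (simp_all add: independent_framework_def)
  obtain \<epsilon>0 where \<epsilon>0: "\<epsilon>0 > 0" "\<And>\<epsilon>. 0 < \<epsilon> \<Longrightarrow> \<epsilon> < \<epsilon>0 \<Longrightarrow> well_positioned G' (substituted_config p r \<epsilon>)"
    using eventually_well_positioned_substituted[OF b smooth_open wp]
    unfolding eventually_at_right_field by auto
  \<comment> \<open>A sequence, to match the sequential continuity of support functionals. The
    factor 1/2 keeps the term at n = 0 below \<open>\<epsilon>0\<close>.\<close>
  define \<epsilon> where "\<epsilon> n = \<epsilon>0 / 2 * inverse (real (Suc n))" for n
  have \<epsilon>_pos: "\<epsilon> n > 0" for n using \<epsilon>0(1) by (simp add: \<epsilon>_def)
  have \<epsilon>_lim: "\<epsilon> \<longlonglongrightarrow> 0"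
    unfolding \<epsilon>_def using LIMSEQ_inverse_real_of_nat by (rule tendsto_mult_right_zero)
  have "\<epsilon> n < \<epsilon>0" for n
  proof -
    have "\<epsilon> n \<le> \<epsilon>0 / 2 * 1"
      unfolding \<epsilon>_def using \<epsilon>0(1) by (intro mult_left_mono) (simp_all add: inverse_le_1_iff)
    then show ?thesis using \<epsilon>0(1) by simp
  qed
  then have wp': "well_positioned G' (substituted_config p r (\<epsilon> n))" for n
    using \<epsilon>0(2) \<epsilon>_pos by blast
  \<comment> \<open>Without this factor the rows of the edges of \<open>H\<close> would tend to 0
    and the limit would be dependent.\<close>
  define s where "s n e = (if e \<in> edges H then inverse (\<epsilon> n) else 1)" for n and e :: "'v set"
  let ?A = "verts G' \<times> {1..d}"
  let ?row = "\<lambda>n. rigidity_row b d G' (substituted_config p r (\<epsilon> n))"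
  define f where "f e = config_of ?A (limit_row b p r e)" for e
  have finA: "finite ?A" using finite_verts by simp
  have lim: "(\<lambda>n. s n e *\<^sub>R ?row n e) \<longlonglongrightarrow> f e" if e: "e \<in> edges G'" for e
  proof (rule tendsto_poly_mapping[OF finA])
    show "Poly_Mapping.keys (s n e *\<^sub>R ?row n e) \<subseteq> ?A" for n
      by (auto simp: in_keys_iff lookup_rigidity_row[OF finite_verts(3)] split: if_splits)
    show "Poly_Mapping.keys (f e) \<subseteq> ?A"
      using config_of_in_config_space[OF finA] by (simp add: f_def config_space_def)
    fix c assume "c \<in> ?A"
    then obtain u k where c: "c = (u, k)" "u \<in> verts G'" "k \<in> {1..d}" by blast
    have "(\<lambda>n. s n e * rigidity_matrix b (substituted_config p r (\<epsilon> n)) e (u, k)) \<longlonglongrightarrow>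
        limit_row b p r e (u, k)"
    proof (cases "e \<in> edges H")
      case True
      have "s n e * rigidity_matrix b (substituted_config p r (\<epsilon> n)) e (u, k) = limit_row b p r e (u, k)" for n
        using \<epsilon>_pos[of n] True by (simp add: s_def rigidity_matrix_substituted_H[OF b wp(2) True \<epsilon>_pos])
      then show ?thesis by simp
    next
      case False
      then have "e \<in> moved_edges" using e by (simp add: edges_eq_Un)
      from rigidity_matrix_substituted_moved_tendsto[OF b wp(1) this wp' \<epsilon>_lim] False
      show ?thesis by (simp add: s_def)
    qed
    then show "(\<lambda>n. Poly_Mapping.lookup (s n e *\<^sub>R ?row n e) c) \<longlonglongrightarrow> Poly_Mapping.lookup (f e) c"
      using c
      by (simp add: f_def lookup_config_of[OF finA] lookup_rigidity_row[OF finite_verts(3)] del: One_nat_def)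
  qed
  have finE: "finite (edges G')"
    by (rule finite_simple_graph_finite_edges[OF finite_simple_graph_substitution])
  have "\<forall>\<^sub>F n in sequentially. \<forall>c. (\<Sum>e\<in>edges G'. c e *\<^sub>R s n e *\<^sub>R ?row n e) = 0 \<longrightarrow> (\<forall>e\<in>edges G'. c e = 0)"
  proof (rule independent_family_perturbation[OF finE])
    fix c assume 0: "(\<Sum>e\<in>edges G'. c e *\<^sub>R f e) = 0"
    show "\<forall>e\<in>edges G'. c e = 0"
    proof (rule limit_rows_independent[OF b p r])
      fix u k assume uk: "u \<in> verts G'" "k \<in> {1..d}"
      have "Poly_Mapping.lookup (\<Sum>e\<in>edges G'. c e *\<^sub>R f e) (u, k) = 0"
        unfolding 0 by simp
      then show "(\<Sum>e\<in>edges G'. c e * limit_row b p r e (u, k)) = 0"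
        using uk by (simp add: lookup_sum f_def lookup_config_of[OF finA] del: One_nat_def)
    qed
  qed (rule lim)
  then obtain n where n: "\<And>c. (\<Sum>e\<in>edges G'. c e *\<^sub>R s n e *\<^sub>R ?row n e) = 0 \<Longrightarrow> \<forall>e\<in>edges G'. c e = 0"
    unfolding eventually_sequentially by blast
  have s0: "s n e \<noteq> 0" for e using \<epsilon>_pos[of n] by (simp add: s_def)
  have "\<forall>e\<in>edges G'. c e = 0" if "(\<Sum>e\<in>edges G'. c e *\<^sub>R ?row n e) = 0" for c
    using n[of "\<lambda>e. c e / s n e"] that s0 by simp
  then have "independent_framework b d G' (substituted_config p r (\<epsilon> n))"
    unfolding independent_framework_def using wp' by blast
  with \<epsilon>_pos show ?thesis using that by blast
qed

text \<open>One direction suffices, since such a substitution can be reversed. With the vertex of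
  \<open>H\<close> at 0 the substituted configuration is the same for all \<epsilon>: it is p
  relabelled along \<open>collapse\<close>, which keeps the dimension of the trivial
  motions.\<close>

lemma rigid_graph_substitution_singleton:
  fixes b :: "nat \<Rightarrow> 'a::real_normed_vector"
  assumes b: "is_basis b d" and smooth_open: "open {x :: 'a. smooth_point x}"
    and indep: "independent_graph b d G" and rigid: "rigid_graph b d G"
    and H: "verts H = {h}" "edges H = {}"
  shows "rigid_graph b d G'"
proof -
  obtain p where p: "independent_framework b d G p"
    and count: "int (card (edges G)) = int (d * card (verts G)) - int (dim (trivial_motions G p))"
    using rigid unfolding rigid_graph_def rigid_framework_iff_independent[OF graph_G indep] by blast
  have p_config: "p \<in> config_space (verts G)"
    using p by (simp add: independent_framework_def well_positioned_def placement_def)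
  have "independent_framework b d H 0"
    by (simp add: independent_framework_def well_positioned_def placement_def H config_space_def)
  from independent_framework_substituted[OF b smooth_open p this]
  obtain \<epsilon> where "independent_framework b d G' (substituted_config p 0 \<epsilon>)" .
  moreover define q where "q = config_of (verts G') (\<lambda>u. Poly_Mapping.lookup p (collapse u))"
  have "substituted_config p 0 \<epsilon> = q" for \<epsilon>
    by (simp add: q_def substituted_config_def)
  ultimately have q: "independent_framework b d G' q" by simp
  have q_config: "q \<in> config_space (verts G')"
    unfolding q_def by (rule config_of_in_config_space[OF finite_verts(3)])
  define expand where "expand v = (if v = v0 then h else v)" for v
  have expand: "expand v \<in> verts G'" "collapse (expand v) = v" if "v \<in> verts G" for v
    using that H(1) disjoint by (auto simp: expand_def collapse_def verts_eq)
  have collapse: "expand (collapse u) = u" if "u \<in> verts G'" for u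
    using that H(1) by (auto simp: expand_def collapse_def verts_eq)
  have "collapse ` verts G' = verts G" "expand ` verts G = verts G'"
    using expand collapse collapse_in_verts by force+
  note relabel = dim_tangent_space_orbit_relabel_le[OF b finite_verts(1,3) this(1) p_config]
    dim_tangent_space_orbit_relabel_le[OF b finite_verts(3,1) this(2) q_config]
  have "config_of (verts G) (\<lambda>v. Poly_Mapping.lookup q (expand v)) = config_of (verts G) (Poly_Mapping.lookup p)"
    unfolding config_of_def
    by (intro sum.cong) (simp_all add: q_def lookup_config_of[OF finite_verts(3)] expand)
  also have "\<dots> = p" by (rule config_of_lookup[OF finite_verts(1) p_config])
  finally have "dim (trivial_motions G' q) = dim (trivial_motions G p)"
    using relabel unfolding q_def[symmetric] trivial_motions_def by simp
  moreover have "independent_graph b d G'" using q unfolding independent_graph_def by blast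
  moreover have "card (verts G') = card (verts G)" "card (edges G') = card (edges G)"
    using card_verts_substitution card_edges_substitution H by simp_all
  ultimately have "rigid_framework b d G' q"
    using q count rigid_framework_iff_independent[OF finite_simple_graph_substitution] by metis
  then show ?thesis unfolding rigid_graph_def by blast
qed

text \<open>Replacing h by \<open>v0\<close> undoes the relabelling, so that
  \<open>rigid_graph_substitution_singleton\<close> also yields the converse.\<close>

lemma substitution_singleton_inverse:
  assumes H: "verts H = {h}" "edges H = {}"
  shows "vertex_substitution G' \<lparr>verts = {v0}, edges = {}\<rparr> G h (\<lambda>_. v0)"
proof
  have h: "h \<notin> verts G - {v0}" using disjoint H(1) by auto
  have \<sigma>h: "\<sigma> w = h" if "{v0, w} \<in> edges G" for w using \<sigma>[OF that] H(1) by simp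
  have no_h: "h \<notin> e" if "e \<in> edges G" "v0 \<notin> e" for e
    using that h graph_G by (auto simp: finite_simple_graph_def)
  have edges: "edges G' = {e \<in> edges G. v0 \<notin> e} \<union> {{h, w} | w. {v0, w} \<in> edges G}"
    unfolding edges_eq H(2) using \<sigma>h by auto
  have "{h, w} \<in> edges G' \<longleftrightarrow> {v0, w} \<in> edges G" for w
    unfolding edges using no_h by (auto simp: doubleton_eq_iff)
  moreover have "{e \<in> edges G'. h \<notin> e} = {e \<in> edges G. v0 \<notin> e}"
    unfolding edges using no_h by auto
  moreover have "edges G = {e \<in> edges G. v0 \<notin> e} \<union> {{v0, w} | w. {v0, w} \<in> edges G}"
  proof -
    have "\<exists>w. e = {v0, w}" if "e \<in> edges G" "v0 \<in> e" for e
      using finite_simple_graph_edgeE[OF graph_G that(1)] that(2)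
      by (metis insertE insert_commute singletonD)
    then show ?thesis by blast
  qed
  ultimately show "edges G = {e \<in> edges G'. h \<notin> e} \<union> edges \<lparr>verts = {v0}, edges = {}\<rparr> \<union>
      {{v0, w} | w. {h, w} \<in> edges G'}"
    by simp
qed (use H v0 disjoint finite_simple_graph_substitution in \<open>auto simp: verts_eq finite_simple_graph_def\<close>)

end

section \<open>Counting edges, by the number of vertices of \<open>H\<close>\<close>

theorem proposition4p10:
  fixes b :: "nat \<Rightarrow> 'a::real_normed_vector" and d :: nat
    and G H G' :: "'v graph" and v0 :: 'v
  assumes basis: "is_basis b d"
    and smooth_open: "open {x :: 'a. smooth_point x}"
    and graph_G: "finite_simple_graph G"
    and graph_H: "finite_simple_graph H"
    and subst: "vertex_to_graph_substitution G v0 H G'"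
    and indep_G: "independent_graph b d G"
    and indep_H: "independent_graph b d H"
  shows "independent_graph b d G' \<and>
    ((\<forall>r :: 'v \<Rightarrow>\<^sub>0 'a. placement H r \<longrightarrow> dim (trivial_motions H r) = d) \<and> rigid_graph b d H
       \<longrightarrow> (rigid_graph b d G' \<longleftrightarrow> rigid_graph b d G))"
proof -
  obtain \<sigma> where "vertex_substitution G H G' v0 \<sigma>"
    using subst graph_G graph_H
    unfolding vertex_to_graph_substitution_def vertex_substitution_def by blast
  then interpret vertex_substitution G H G' v0 \<sigma> .
  have graph_G': "finite_simple_graph G'" by (rule finite_simple_graph_substitution)
  have indep_G': "independent_graph b d G'"
    using indep_G indep_H independent_framework_substituted[OF basis smooth_open]
    unfolding independent_graph_def by metis
  moreover have "rigid_graph b d G' \<longleftrightarrow> rigid_graph b d G"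
    if dimH: "\<forall>r :: 'v \<Rightarrow>\<^sub>0 'a. placement H r \<longrightarrow> dim (trivial_motions H r) = d"
      and rigidH: "rigid_graph b d H"
  proof -
    obtain r where "independent_framework b d H r"
      and "int (card (edges H)) = int (d * card (verts H)) - int (dim (trivial_motions H r))"
      using rigidH unfolding rigid_graph_def rigid_framework_iff_independent[OF graph_H indep_H] by blast
    then have count_H: "int (card (edges H)) = int (d * card (verts H)) - int d"
      using dimH by (simp add: independent_framework_def well_positioned_def)
    \<comment> \<open>The counting argument, once all trivial motions are known to have dimension d.
      An empty framework has only the motion 0, so it must be excluded unless d = 0.\<close>
    have trivial: ?thesis
      if dim: "\<And>K (q :: 'v \<Rightarrow>\<^sub>0 'a). finite_simple_graph K \<Longrightarrow> verts K \<noteq> {} \<or> d = 0 \<Longrightarrow>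
          placement K q \<Longrightarrow> dim (trivial_motions K q) = d"
        and ne: "verts H \<noteq> {} \<or> d = 0"
    proof -
      have rigid_iff: "rigid_graph b d K \<longleftrightarrow> int (card (edges K)) = int (d * card (verts K)) - int d"
        if K: "finite_simple_graph K" "independent_graph b d K" "verts K \<noteq> {} \<or> d = 0" for K :: "'v graph"
      proof -
        have "dim (trivial_motions K q) = d" if "independent_framework b d K q" for q
          using dim[OF K(1,3)] that by (simp add: independent_framework_def well_positioned_def)
        then show ?thesis
          using K(2) unfolding rigid_graph_def rigid_framework_iff_independent[OF K(1,2)]
          unfolding independent_graph_def by metis
      qed
      have "int (d * card (verts G')) + int d = int (d * card (verts G)) + int (d * card (verts H))"
        using arg_cong[OF card_verts_substitution, of "\<lambda>n. int (d * n)"] by (simp add: algebra_simps)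
      moreover have "verts G \<noteq> {}" "verts G' \<noteq> {} \<or> d = 0"
        using v0 ne by (auto simp: verts_eq)
      ultimately show ?thesis
        using rigid_iff[OF graph_G indep_G] rigid_iff[OF graph_G' indep_G'] count_H card_edges_substitution
        by simp (rule iffI; linarith)
    qed
    consider "d = 0" | "d > 0" "verts H = {}" | h where "d > 0" "verts H = {h}"
      | a1 a2 where "d > 0" "a1 \<in> verts H" "a2 \<in> verts H" "a1 \<noteq> a2"
      by (cases "verts H = {}"; cases "d = 0") blast+
    then show ?thesis
    proof cases
      case 1
      then have "x = 0" for x :: 'a
        using basis_coord_sum[OF basis, of x] by simp
      then have "q = 0" for q :: "'v \<Rightarrow>\<^sub>0 'a"
        by (intro poly_mapping_eqI) metis
      then have "T \<subseteq> span {}" for T :: "('v \<Rightarrow>\<^sub>0 'a) set" by auto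
      then have "dim T = 0" for T :: "('v \<Rightarrow>\<^sub>0 'a) set"
        using real_vector.dim_le_card[of T "{}"] by simp
      with 1 show ?thesis by (intro trivial) auto
    next
      \<comment> \<open>An empty \<open>H\<close> has only the motion 0, which contradicts the
        hypothesis on its dimension.\<close>
      case 2
      have "placement H (0 :: 'v \<Rightarrow>\<^sub>0 'a)"
        using 2(2) graph_H by (auto simp: placement_def config_space_def finite_simple_graph_def)
      then have "dim (trivial_motions H (0 :: 'v \<Rightarrow>\<^sub>0 'a)) = d" using dimH by blast
      moreover have "trivial_motions H (0 :: 'v \<Rightarrow>\<^sub>0 'a) \<subseteq> config_space {}"
        unfolding trivial_motions_def 2(2) by (rule tangent_space_orbit_subset)
      then have "trivial_motions H (0 :: 'v \<Rightarrow>\<^sub>0 'a) \<subseteq> span {}"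
        by (simp add: config_space_def)
      then have "dim (trivial_motions H (0 :: 'v \<Rightarrow>\<^sub>0 'a)) \<le> card ({} :: ('v \<Rightarrow>\<^sub>0 'a) set)"
        by (rule real_vector.dim_le_card) simp
      ultimately show ?thesis using 2(1) by simp
    next
      case (3 h)
      \<comment> \<open>For one vertex the rigidity count is d - d = 0.\<close>
      have "edges H = {}"
        using count_H 3(2) finite_edges(2) by simp
      note H = 3(2) this
      interpret inverse: vertex_substitution G' "\<lparr>verts = {v0}, edges = {}\<rparr>" G h "\<lambda>_. v0"
        by (rule substitution_singleton_inverse[OF H])
      show ?thesis
        using rigid_graph_substitution_singleton[OF basis smooth_open indep_G _ H]
          inverse.rigid_graph_substitution_singleton[OF basis smooth_open indep_G', of v0] by auto
    next
      case (4 a1 a2)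
      show ?thesis
      proof (rule trivial)
        fix K and q :: "'v \<Rightarrow>\<^sub>0 'a"
        assume K: "finite_simple_graph K" "verts K \<noteq> {} \<or> d = 0" "placement K q"
        have V: "finite (verts K)" "verts K \<noteq> {}" and q: "q \<in> config_space (verts K)"
          using K 4(1) by (auto simp: finite_simple_graph_def placement_def)
        have "trivial_motions K q = range (translation_motion (verts K))"
          unfolding trivial_motions_def
          using dimH by (intro tangent_space_orbit_eq_translations[OF basis graph_H 4(2-4) _ V q]) blast
        then show "dim (trivial_motions K q) = d"
          using dim_translation_motions[OF basis V] by simp
      qed (use 4(2) in auto)
    qed
  qed
  ultimately show ?thesis by blast
qed

end
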